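(* Let $\alpha,b,x_1,\dots,x_n,a_1,\dots,a_n$ be complex parameters such that no denominator in the identity below vanishes. Let $f(y_1,\dots,y_n)$ be a complex function of $n$ variables (defined at all points where it is evaluated below). Assume that either (i) $f$ is such that both sides of the identity are analytic in $a_1,\dots,a_n$ and the series converges absolutely for each $a_r$ in a disk around the origin, and each $a_r$ lies in this disk; or (ii) $a_r=q^{N_r}$ with $N_r$ a positive integer for $r=1,\dots,n$ (so that the series terminates). Then $$\begin{aligned} & f(\alpha a_{1},\dots,\alpha a_{n})\frac{(\alpha q,\alpha a_{1}\cdots a_{n}b/q^{n})_{\infty}}{(\alpha b,\alpha a_{1}\cdots a_{n}q^{1-n})_{\infty}}\\ &=\sum_{k_1,\dots,k_n\ge0}\ \prod_{1\leq r<s\leq n}\frac{1-q^{k_{r}-k_{s}}x_{r}/x_{s}}{1-x_{r}/x_{s}}\prod_{r,s=1}^{n}\frac{(qx_{r}/(x_{s}a_{s}))_{k_{r}}}{(qx_{r}/x_{s})_{k_{r}}}\\ &\quad\times\frac{(1-\alpha q^{2|\boldsymbol{k}|})(\alpha)_{|\boldsymbol{k}|}}{(1-\alpha)(\alpha a_{1}\cdots a_{n}q^{1-n})_{|\boldsymbol{k}|}}(a_{1}\cdots a_{n})^{|\boldsymbol{k}|}q^{\sum_{r=1}^{n}(r-1)k_{r}-n|\boldsymbol{k}|}\\ &\quad\times\sum_{\substack{0\leq m_{r}\leq k_{r}\\ r=1,\dots,n}}\ \prod_{1\leq r<s\leq n}\frac{1-q^{m_{r}-m_{s}}x_{r}/x_{s}}{1-x_{r}/x_{s}}\prod_{r,s=1}^{n}\frac{(q^{-k_{s}}x_{r}/x_{s})_{m_{r}}}{(qx_{r}/x_{s})_{m_{r}}}\cdot\frac{(\alpha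 q^{|\boldsymbol{k}|})_{|\boldsymbol{m}|}}{(\alpha b)_{|\boldsymbol{m}|}}q^{\sum_{r=1}^{n}rm_{r}}f(\alpha q^{1+m_{1}},\dots,\alpha q^{1+m_{n}}). \end{aligned}$$
   Context: $q$ is a complex number with $0<|q|<1$ and $n\ge1$ is an integer. $(z)_\infty=\prod_{i\ge0}(1-zq^i)$ and $(z)_k=(z)_\infty/(zq^k)_\infty=\prod_{i=0}^{k-1}(1-zq^i)$; $(c_1,\dots,c_p)_k=(c_1)_k\cdots(c_p)_k$ for $k$ a nonnegative integer or $\infty$. Bold letters denote multi-indices of nonnegative integers, $\boldsymbol k=(k_1,\dots,k_n)$, with $|\boldsymbol k|=k_1+\cdots+k_n$. If some $a_s=0$, the expression $\prod_{r,s}(qx_r/(x_sa_s))_{k_r}(a_1\cdots a_n)^{|\boldsymbol k|}$, which is polynomial in the $a_s$, is understood by continuity. *)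

theory Defs
  imports "HOL-Analysis.Analysis"
begin

text \<open>
  The variables \<open>x\<^sub>1, \<dots>, x\<^sub>n\<close> and \<open>a\<^sub>1, \<dots>, a\<^sub>n\<close> are functions on \<^typ>\<open>nat\<close> of which only the values
  on \<open>{1..n}\<close> matter.  A function of \<open>n\<close> variables takes its argument in \<open>{1..n} \<rightarrow>\<^sub>E UNIV\<close>, so it is
  always applied to a tuple restricted to \<open>{1..n}\<close>; likewise multi-indices range over
  \<open>{1..n} \<rightarrow>\<^sub>E UNIV\<close>, which makes each of them occur exactly once in a sum.
\<close>

definition qpoch :: "complex \<Rightarrow> complex \<Rightarrow> nat \<Rightarrow> complex" where
  "qpoch q z k = (\<Prod>i<k. 1 - z * q ^ i)"

definition qpoch_inf :: "complex \<Rightarrow> complex \<Rightarrow> complex" where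
  "qpoch_inf q z = (\<Prod>i. 1 - z * q ^ i)"

definition total :: "nat \<Rightarrow> (nat \<Rightarrow> nat) \<Rightarrow> nat" where
  "total n k = (\<Sum>r=1..n. k r)"

definition multi_indices :: "nat \<Rightarrow> (nat \<Rightarrow> nat) set" where
  "multi_indices n = ({1..n} \<rightarrow>\<^sub>E UNIV)"

definition vandermonde_ratio :: "nat \<Rightarrow> complex \<Rightarrow> (nat \<Rightarrow> complex) \<Rightarrow> (nat \<Rightarrow> nat) \<Rightarrow> complex" where
  "vandermonde_ratio n q x k =
     (\<Prod>r=1..n. \<Prod>s=Suc r..n. (1 - q powi (int (k r) - int (k s)) * (x r / x s)) / (1 - x r / x s))"

definition numerator_raw ::
  "nat \<Rightarrow> complex \<Rightarrow> (nat \<Rightarrow> complex) \<Rightarrow> (nat \<Rightarrow> nat) \<Rightarrow> (nat \<Rightarrow> complex) \<Rightarrow> complex" where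
  "numerator_raw n q x k a =
     (\<Prod>r=1..n. \<Prod>s=1..n. qpoch q (q * x r / (x s * a s)) (k r)) * (\<Prod>s=1..n. a s) ^ total n k"

text \<open>The extension by continuity to points at which some \<open>a\<^sub>s\<close> is zero.\<close>

definition numerator ::
  "nat \<Rightarrow> complex \<Rightarrow> (nat \<Rightarrow> complex) \<Rightarrow> (nat \<Rightarrow> nat) \<Rightarrow> (nat \<Rightarrow> complex) \<Rightarrow> complex" where
  "numerator n q x k a =
     (if \<forall>s\<in>{1..n}. a s \<noteq> 0 then numerator_raw n q x k a
      else Lim (at a within {a'. \<forall>s\<in>{1..n}. a' s \<noteq> 0}) (numerator_raw n q x k))"

lemma numerator_raw_eq_polynomial:
  assumes "\<forall>s\<in>{1..n}. a s \<noteq> 0"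
  shows "numerator_raw n q x k a = (\<Prod>r=1..n. \<Prod>s=1..n. \<Prod>i<k r. a s - q ^ Suc i * x r / x s)"
proof -
  have "(\<Prod>i<k r. a s - q ^ Suc i * x r / x s) = qpoch q (q * x r / (x s * a s)) (k r) * a s ^ k r"
    if "s \<in> {1..n}" for r s
  proof -
    have "a s \<noteq> 0" using assms that by blast
    then have "a s - q ^ Suc i * x r / x s = (1 - q * x r / (x s * a s) * q ^ i) * a s" for i
      by (cases "x s = 0") (simp_all add: field_simps)
    then show ?thesis
      by (simp add: qpoch_def prod.distrib)
  qed
  moreover have "(\<Prod>r=1..n. \<Prod>s=1..n. a s ^ k r) = (\<Prod>s=1..n. a s) ^ total n k"
    by (simp add: total_def power_sum prod_power_distrib)
  ultimately show ?thesis
    by (simp add: numerator_raw_def prod.distrib)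
qed

lemma numerator_eq_polynomial:
  "numerator n q x k a = (\<Prod>r=1..n. \<Prod>s=1..n. \<Prod>i<k r. a s - q ^ Suc i * x r / x s)"
proof (cases "\<forall>s\<in>{1..n}. a s \<noteq> 0")
  case True
  then show ?thesis by (simp add: numerator_def numerator_raw_eq_polynomial)
next
  case False
  let ?S = "{a'::nat \<Rightarrow> complex. \<forall>s\<in>{1..n}. a' s \<noteq> 0}"
  let ?P = "\<lambda>a'. \<Prod>r=1..n. \<Prod>s=1..n. \<Prod>i<k r. a' s - q ^ Suc i * x r / x s"
  have coord: "((\<lambda>a'. a' s) \<longlongrightarrow> a s) (at a within ?S)" for s
  proof -
    have "continuous_on UNIV (\<lambda>a'::nat \<Rightarrow> complex. a' s)"
      by (rule continuous_on_product_coordinates)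
    then have "((\<lambda>a'. a' s) \<longlongrightarrow> a s) (at a)"
      by (simp add: continuous_on_def)
    then show ?thesis
      by (rule tendsto_within_subset) simp
  qed
  have "(?P \<longlongrightarrow> ?P a) (at a within ?S)"
    by (intro tendsto_prod tendsto_diff tendsto_const coord)
  moreover have "\<forall>\<^sub>F a' in at a within ?S. ?P a' = numerator_raw n q x k a'"
    by (auto simp: eventually_at_filter numerator_raw_eq_polynomial)
  ultimately have lim: "(numerator_raw n q x k \<longlongrightarrow> ?P a) (at a within ?S)"
    by (rule Lim_transform_eventually)
  define g where "g = (\<lambda>t::complex. \<lambda>s. if a s = 0 then t else a s)"
  have "continuous_on UNIV g"
  proof (rule continuous_on_coordinatewise_then_product)
    show "continuous_on UNIV (\<lambda>t. g t s)" for s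
      by (cases "a s = 0") (simp_all add: g_def)
  qed
  then have "(g \<longlongrightarrow> g 0) (at 0)"
    by (simp add: continuous_on_def)
  moreover have "g 0 = a"
    by (auto simp: g_def)
  moreover have "g t \<in> ?S - {a}" if "t \<noteq> 0" for t
    using False that by (auto simp: g_def fun_eq_iff)
  then have "\<forall>\<^sub>F t in at 0. g t \<in> ?S \<and> g t \<noteq> a"
    unfolding eventually_at_filter by (intro always_eventually) simp
  ultimately have "filterlim g (at a within ?S) (at 0)"
    by (simp add: filterlim_at)
  then have "at a within ?S \<noteq> bot"
    by (auto simp: filterlim_def filtermap_bot_iff bot_unique)
  from tendsto_Lim[OF this lim] show ?thesis
    unfolding numerator_def by (simp only: False if_False)
qed

definition lhs ::
  "nat \<Rightarrow> complex \<Rightarrow> complex \<Rightarrow> complex \<Rightarrow> ((nat \<Rightarrow> complex) \<Rightarrow> complex) \<Rightarrow> (nat \<Rightarrow> complex) \<Rightarrow> complex"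
where
  "lhs n q \<alpha> b f a =
     f (\<lambda>r\<in>{1..n}. \<alpha> * a r) *
     ((qpoch_inf q (\<alpha> * q) * qpoch_inf q (\<alpha> * (\<Prod>s=1..n. a s) * b / q ^ n)) /
      (qpoch_inf q (\<alpha> * b) * qpoch_inf q (\<alpha> * (\<Prod>s=1..n. a s) * q powi (1 - int n))))"

definition inner_sum ::
  "nat \<Rightarrow> complex \<Rightarrow> complex \<Rightarrow> complex \<Rightarrow> (nat \<Rightarrow> complex) \<Rightarrow> ((nat \<Rightarrow> complex) \<Rightarrow> complex) \<Rightarrow>
   (nat \<Rightarrow> nat) \<Rightarrow> complex"
where
  "inner_sum n q \<alpha> b x f k =
     (\<Sum>m\<in>(\<Pi>\<^sub>E r\<in>{1..n}. {0..k r}).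
        vandermonde_ratio n q x m *
        (\<Prod>r=1..n. \<Prod>s=1..n.
           qpoch q (q powi (- int (k s)) * x r / x s) (m r) / qpoch q (q * x r / x s) (m r)) *
        (qpoch q (\<alpha> * q ^ total n k) (total n m) / qpoch q (\<alpha> * b) (total n m)) *
        q ^ (\<Sum>r=1..n. r * m r) *
        f (\<lambda>r\<in>{1..n}. \<alpha> * q ^ (1 + m r)))"

definition outer_term ::
  "nat \<Rightarrow> complex \<Rightarrow> complex \<Rightarrow> complex \<Rightarrow> (nat \<Rightarrow> complex) \<Rightarrow> ((nat \<Rightarrow> complex) \<Rightarrow> complex) \<Rightarrow>
   (nat \<Rightarrow> complex) \<Rightarrow> (nat \<Rightarrow> nat) \<Rightarrow> complex"
where
  "outer_term n q \<alpha> b x f a k =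
     vandermonde_ratio n q x k *
     (numerator n q x k a / (\<Prod>r=1..n. \<Prod>s=1..n. qpoch q (q * x r / x s) (k r))) *
     (((1 - \<alpha> * q ^ (2 * total n k)) * qpoch q \<alpha> (total n k)) /
      ((1 - \<alpha>) * qpoch q (\<alpha> * (\<Prod>s=1..n. a s) * q powi (1 - int n)) (total n k))) *
     q powi (int (\<Sum>r=1..n. (r - 1) * k r) - int (n * total n k)) *
     inner_sum n q \<alpha> b x f k"

definition denominators_nonzero ::
  "nat \<Rightarrow> complex \<Rightarrow> complex \<Rightarrow> complex \<Rightarrow> (nat \<Rightarrow> complex) \<Rightarrow> (nat \<Rightarrow> complex) \<Rightarrow> bool"
where
  "denominators_nonzero n q \<alpha> b x a \<longleftrightarrow>
     (\<forall>r\<in>{1..n}. x r \<noteq> 0) \<and>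
     (\<forall>r\<in>{1..n}. \<forall>s\<in>{1..n}. r < s \<longrightarrow> 1 - x r / x s \<noteq> 0) \<and>
     (\<forall>r\<in>{1..n}. \<forall>s\<in>{1..n}. \<forall>k. qpoch q (q * x r / x s) k \<noteq> 0) \<and>
     1 - \<alpha> \<noteq> 0 \<and>
     (\<forall>k. qpoch q (\<alpha> * (\<Prod>s=1..n. a s) * q powi (1 - int n)) k \<noteq> 0) \<and>
     (\<forall>k. qpoch q (\<alpha> * b) k \<noteq> 0) \<and>
     qpoch_inf q (\<alpha> * b) \<noteq> 0 \<and>
     qpoch_inf q (\<alpha> * (\<Prod>s=1..n. a s) * q powi (1 - int n)) \<noteq> 0"

definition polydisc :: "nat \<Rightarrow> real \<Rightarrow> (nat \<Rightarrow> complex) set" where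
  "polydisc n R = {a. \<forall>r\<in>{1..n}. norm (a r) < R}"

text \<open>
  Joint analyticity in \<open>a\<^sub>1, \<dots>, a\<^sub>n\<close>: around each point, the function is the sum of a power
  series in \<open>n\<close> variables.  For complex series, \<^const>\<open>has_sum\<close> is absolute convergence.
\<close>

definition analytic_in_variables ::
  "nat \<Rightarrow> ((nat \<Rightarrow> complex) \<Rightarrow> complex) \<Rightarrow> (nat \<Rightarrow> complex) set \<Rightarrow> bool"
where
  "analytic_in_variables n F D \<longleftrightarrow>
     (\<forall>p\<in>D. \<exists>\<epsilon>>0. \<exists>c. \<forall>a. (\<forall>r\<in>{1..n}. dist (a r) (p r) < \<epsilon>) \<longrightarrow>
        ((\<lambda>k. c k * (\<Prod>r=1..n. (a r - p r) ^ k r)) has_sum F a) (multi_indices n))"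

end

theory Submission
  imports Defs "HOL-Complex_Analysis.Complex_Analysis"
begin

text \<open>
  Suppose first that \<open>a\<^sub>r = q\<^bsup>M\<^sub>r + 1\<^esup>\<close>, and exchange the two sums.  The coefficient of
  \<open>f(\<alpha>q\<^bsup>1 + m\<^esup>)\<close> is a sum over \<open>m \<le> k \<le> M\<close> of a weight free of \<open>\<alpha>\<close> times a factor depending only on
  \<open>|k|\<close>.  Let \<open>S\<^sub>K\<close> be the sum of the weights with \<open>|k| = K\<close>.  Partial fractions at the nodes
  \<open>x\<^sub>r q\<^bsup>k\<^sub>r\<^esup>\<close> give
  \<open>(q\<^bsup>|m|\<^esup> - q\<^bsup>K + 1\<^esup>) S\<^bsub>K + 1\<^esub> = (1 - q\<^bsup>K - |M|\<^esup>) S\<^sub>K\<close>, and with this recurrence the sum over \<open>K\<close>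
  telescopes to zero unless \<open>m = M\<close>, when a single term remains, which is a product.

  In the analytic case both sides agree at all points \<open>(q\<^bsup>N\<^sub>1\<^esup>, \<dots>, q\<^bsup>N\<^sub>n\<^esup>)\<close> with large \<open>N\<^sub>r\<close>.  These
  accumulate at the origin in each coordinate, so the identity theorem, applied to one variable at
  a time, gives agreement on the whole polydisc.
\<close>

declare One_nat_def [simp del]

section \<open>Partial fractions\<close>

lemma degree_prod_linear_le:
  fixes c :: "'i \<Rightarrow> 'a::field"
  shows "finite I \<Longrightarrow> degree (\<Prod>s\<in>I. [:1, c s:]) \<le> card I"
proof (induction I rule: finite_induct)
  case (insert t I)
  have "degree ([:1, c t:] * (\<Prod>s\<in>I. [:1, c s:])) \<le> degree [:1, c t:] + degree (\<Prod>s\<in>I. [:1, c s:])"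
    by (rule degree_mult_le)
  also have "\<dots> \<le> 1 + card I"
    using insert.IH by (intro add_mono) simp_all
  finally show ?case using insert.hyps by simp
qed simp

lemma coeff_prod_linear_card:
  fixes c :: "'i \<Rightarrow> 'a::field"
  shows "finite I \<Longrightarrow> coeff (\<Prod>s\<in>I. [:1, c s:]) (card I) = (\<Prod>s\<in>I. c s)"
proof (induction I rule: finite_induct)
  case (insert t I)
  have "coeff (\<Prod>s\<in>I. [:1, c s:]) (Suc (card I)) = 0"
    using degree_prod_linear_le[OF insert.hyps(1), of c] by (intro coeff_eq_0) simp
  with insert show ?case by simp
qed simp

text \<open>Lagrange interpolation read off at 0. The basis polynomials are normalised to constant
  term 1, so at 0 each contributes only the reciprocal of its value at its own node.\<close>

lemma lagrange_at_zero:
  fixes z :: "'i \<Rightarrow> 'a::field"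
  assumes fin: "finite I" and inj: "inj_on z I" and nz: "\<And>r. r \<in> I \<Longrightarrow> z r \<noteq> 0"
    and deg: "degree p < card I"
  shows "(\<Sum>r\<in>I. poly p (z r) / (\<Prod>s\<in>I - {r}. 1 - z r / z s)) = poly p 0"
proof -
  define l where "l r = (\<Prod>s\<in>I - {r}. [:1, - 1 / z s:])" for r
  define L where "L = (\<Sum>r\<in>I. smult (poly p (z r) / (\<Prod>s\<in>I - {r}. 1 - z r / z s)) (l r))"
  have pl: "poly (l r) w = (\<Prod>s\<in>I - {r}. 1 - w / z s)" for r w
    by (simp add: l_def poly_prod)
  have "degree (l r) < card I" if "r \<in> I" for r
  proof -
    have "degree (l r) \<le> card (I - {r})"
      unfolding l_def by (rule degree_prod_linear_le) (use fin in simp)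
    also have "\<dots> < card I" using fin that by (intro card_Diff1_less)
    finally show ?thesis .
  qed
  then have degL: "degree L < card I"
    unfolding L_def using deg
    by (intro degree_sum_less) (auto intro: le_less_trans[OF degree_smult_le])
  have pL: "poly p w = poly L w" if "w \<in> z ` I" for w
  proof -
    from that obtain t where t: "t \<in> I" "w = z t" by blast
    have "(\<Prod>s\<in>I - {t}. 1 - z t / z s) \<noteq> 0"
      using fin t(1) inj nz by (auto simp: prod_zero_iff inj_on_def)
    moreover have "(\<Prod>s\<in>I - {r}. 1 - z t / z s) = 0" if "r \<in> I - {t}" for r
      using fin t(1) nz that by (auto simp: prod_zero_iff intro!: bexI[of _ t])
    then have "(\<Sum>r\<in>I - {t}. poly p (z r) / (\<Prod>s\<in>I - {r}. 1 - z r / z s) *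
        (\<Prod>s\<in>I - {r}. 1 - z t / z s)) = 0"
      by (intro sum.neutral) auto
    ultimately show ?thesis
      using fin t by (simp add: L_def poly_sum pl sum.remove[OF fin t(1)])
  qed
  have "p = L"
    by (rule poly_eqI_degree[of "z ` I"]) (use pL deg degL inj in \<open>auto simp: card_image\<close>)
  then have "poly p 0 = poly L 0" by simp
  then show ?thesis by (simp add: L_def poly_sum pl)
qed

text \<open>The numerator \<open>P\<close> may have degree \<open>card I\<close>, one too many for
  interpolation. Subtracting a multiple of \<open>Q\<close>, which vanishes at all nodes, removes
  the top coefficient and keeps the values there; the multiple is the ratio of the top
  coefficients.\<close>

lemma partial_fraction_sum:
  fixes z b :: "'i \<Rightarrow> 'a::field"
  assumes fin: "finite I" and ne: "I \<noteq> {}" and inj: "inj_on z I" and nz: "\<And>r. r \<in> I \<Longrightarrow> z r \<noteq> 0"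
  shows "(\<Sum>r\<in>I. (\<Prod>s\<in>I. 1 - b s * z r / z s) / (\<Prod>s\<in>I - {r}. 1 - z r / z s)) = 1 - (\<Prod>s\<in>I. b s)"
proof -
  define P where "P = (\<Prod>s\<in>I. [:1, - b s / z s:])"
  define Q where "Q = (\<Prod>s\<in>I. [:1, - 1 / z s:])"
  define p where "p = P - smult (\<Prod>s\<in>I. b s) Q"
  have pos: "card I > 0" using fin ne by (simp add: card_gt_0_iff)
  have dP: "degree P \<le> card I" and dQ: "degree Q \<le> card I"
    unfolding P_def Q_def by (rule degree_prod_linear_le[OF fin])+
  have "degree p \<le> card I"
    unfolding p_def by (intro degree_diff_le dP order_trans[OF degree_smult_le] dQ)
  moreover have "coeff p (card I) = 0"
    by (simp add: p_def P_def Q_def coeff_prod_linear_card[OF fin] flip: prod.distrib)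
  ultimately have deg: "degree p < card I"
    using pos by (metis eq_zero_or_degree_less degree_0 le_neq_implies_less leading_coeff_0_iff)
  have "poly Q (z r) = 0" if "r \<in> I" for r
    using that fin nz by (auto simp: Q_def poly_prod prod_zero_iff)
  then have "poly p (z r) = (\<Prod>s\<in>I. 1 - b s * z r / z s)" if "r \<in> I" for r
    using that by (simp add: p_def P_def poly_prod mult.commute)
  moreover have "poly p 0 = 1 - (\<Prod>s\<in>I. b s)"
    by (simp add: p_def P_def Q_def poly_prod)
  ultimately show ?thesis
    using lagrange_at_zero[OF fin inj nz deg] by (simp cong: sum.cong)
qed

section \<open>Products over pairs\<close>

text \<open>Lets a full double product be merged factor by factor with a Vandermonde product, which
  runs over \<open>r < s\<close> only.\<close>

lemma prod_pairs_split:
  fixes F :: "nat \<Rightarrow> nat \<Rightarrow> 'a::comm_monoid_mult"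
  shows "(\<Prod>r=1..n. \<Prod>s=1..n. F r s) =
         (\<Prod>r=1..n. F r r) * (\<Prod>r=1..n. \<Prod>s=Suc r..n. F r s * F s r)"
proof (induction n)
  case (Suc n)
  have "(\<Prod>r=1..n. \<Prod>s=Suc r..Suc n. F r s * F s r) =
        (\<Prod>r=1..n. \<Prod>s=Suc r..n. F r s * F s r) * (\<Prod>r=1..n. F r (Suc n) * F (Suc n) r)"
    by (simp add: prod.distrib[symmetric] cong: prod.cong_simp)
  then show ?case using Suc
    by (simp add: prod.distrib algebra_simps)
qed simp

lemma prod_pairs_snd:
  fixes F :: "nat \<Rightarrow> 'a::comm_monoid_mult"
  shows "(\<Prod>r=1..n. \<Prod>s=Suc r..n. F s) = (\<Prod>s=1..n. F s ^ (s - 1))"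
proof (induction n)
  case (Suc n)
  have "(\<Prod>r=1..n. \<Prod>s=Suc r..Suc n. F s) = (\<Prod>r=1..n. (\<Prod>s=Suc r..n. F s) * F (Suc n))"
    by (intro prod.cong) simp_all
  then show ?case using Suc by (simp add: prod.distrib)
qed simp

text \<open>Pairs avoiding \<open>t\<close> contribute equally to both sides. The relation is
  cross-multiplied because a commutative monoid offers no division.\<close>

lemma prod_pairs_update:
  fixes G G' :: "nat \<Rightarrow> nat \<Rightarrow> 'a::comm_monoid_mult"
  assumes t: "t \<in> {1..n}"
    and sym: "\<And>r s. G r s = G s r" "\<And>r s. G' r s = G' s r"
    and same: "\<And>r s. r \<noteq> t \<Longrightarrow> s \<noteq> t \<Longrightarrow> G' r s = G r s"
  shows "(\<Prod>r=1..n. \<Prod>s=Suc r..n. G' r s) * (\<Prod>s\<in>{1..n} - {t}. G t s) =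
         (\<Prod>r=1..n. \<Prod>s=Suc r..n. G r s) * (\<Prod>s\<in>{1..n} - {t}. G' t s)"
proof -
  define P where "P = (SIGMA r:{1..n}. {Suc r..n})"
  define T where "T = {p\<in>P. fst p = t \<or> snd p = t}"
  have finP: "finite P" by (simp add: P_def)
  have rest: "(\<Prod>p\<in>P - T. case p of (r, s) \<Rightarrow> G' r s) = (\<Prod>p\<in>P - T. case p of (r, s) \<Rightarrow> G r s)"
    by (intro prod.cong) (auto simp: T_def same)
  \<comment> \<open>A pair containing \<open>t\<close> is determined by its other entry, and
    symmetry of \<open>K\<close> makes the order within the pair immaterial.\<close>
  have T: "(\<Prod>p\<in>T. case p of (r, s) \<Rightarrow> K r s) = (\<Prod>s\<in>{1..n} - {t}. K t s)"
    if "\<And>r s. K r s = K s r" for K :: "nat \<Rightarrow> nat \<Rightarrow> 'a"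
    by (rule prod.reindex_bij_witness[where
          j = "\<lambda>p. if fst p = t then snd p else fst p" and
          i = "\<lambda>s. if s < t then (s, t) else (t, s)"])
       (use t that in \<open>auto simp: T_def P_def split: if_splits\<close>)
  have split: "(\<Prod>r=1..n. \<Prod>s=Suc r..n. K r s) =
      (\<Prod>p\<in>P - T. case p of (r, s) \<Rightarrow> K r s) * (\<Prod>p\<in>T. case p of (r, s) \<Rightarrow> K r s)" for K :: "nat \<Rightarrow> nat \<Rightarrow> 'a"
  proof -
    have "(\<Prod>r=1..n. \<Prod>s=Suc r..n. K r s) = (\<Prod>p\<in>P. case p of (r, s) \<Rightarrow> K r s)"
      by (simp add: P_def prod.Sigma)
    also have "\<dots> = (\<Prod>p\<in>P - T. case p of (r, s) \<Rightarrow> K r s) * (\<Prod>p\<in>T. case p of (r, s) \<Rightarrow> K r s)"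
      by (rule prod.subset_diff) (use finP in \<open>auto simp: T_def\<close>)
    finally show ?thesis .
  qed
  show ?thesis
    by (simp only: split rest T[OF sym(1)] T[OF sym(2)] ac_simps)
qed

section \<open>The q-shifted factorial\<close>

lemma qpoch_0 [simp]: "qpoch q z 0 = 1"
  by (simp add: qpoch_def)

lemma qpoch_Suc: "qpoch q z (Suc k) = qpoch q z k * (1 - z * q ^ k)"
  by (simp add: qpoch_def)

lemma qpoch_Suc_left: "qpoch q z (Suc k) = (1 - z) * qpoch q (z * q) k"
  by (simp add: qpoch_def prod.lessThan_Suc_shift mult.assoc del: prod.lessThan_Suc)

lemma qpoch_add: "qpoch q z (k + l) = qpoch q z k * qpoch q (z * q ^ k) l"
  by (induction l) (simp_all add: qpoch_Suc power_add mult.assoc)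

lemma qpoch_eq_0_iff: "qpoch q z k = 0 \<longleftrightarrow> (\<exists>i<k. z * q ^ i = 1)"
  by (auto simp: qpoch_def)

lemma qpoch_convergent:
  fixes q z :: complex
  assumes "norm q < 1"
  shows "convergent_prod (\<lambda>i. 1 - z * q ^ i)"
proof -
  have "summable (\<lambda>i. norm (z * q ^ i))"
    using assms by (auto simp: norm_mult norm_power intro!: summable_mult summable_geometric)
  then have "abs_convergent_prod (\<lambda>i. 1 - z * q ^ i)"
    by (simp add: abs_convergent_prod_conv_summable)
  then show ?thesis by (rule abs_convergent_prod_imp_convergent_prod)
qed

lemma qpoch_tendsto:
  assumes "norm q < 1"
  shows "qpoch q z \<longlonglongrightarrow> qpoch_inf q z"
proof -
  have "(\<lambda>k. qpoch q z (Suc k)) \<longlonglongrightarrow> qpoch_inf q z"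
    using convergent_prod_LIMSEQ[OF qpoch_convergent[OF assms, of z]]
    by (simp add: qpoch_def qpoch_inf_def lessThan_Suc_atMost)
  then show ?thesis by (rule LIMSEQ_imp_Suc)
qed

lemma qpoch_inf_split:
  assumes "norm q < 1"
  shows "qpoch_inf q z = qpoch q z k * qpoch_inf q (z * q ^ k)"
proof (rule LIMSEQ_unique)
  show "(\<lambda>l. qpoch q z (k + l)) \<longlonglongrightarrow> qpoch_inf q z"
    using LIMSEQ_ignore_initial_segment[OF qpoch_tendsto[OF assms, of z], of k]
    by (simp add: add.commute)
  show "(\<lambda>l. qpoch q z (k + l)) \<longlonglongrightarrow> qpoch q z k * qpoch_inf q (z * q ^ k)"
    unfolding qpoch_add by (intro tendsto_mult tendsto_const qpoch_tendsto assms)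
qed

text \<open>No factor vanishes because \<open>z * q ^ i\<close> stays inside the unit disc. This
  secures the denominators at the sample points of the analytic case, where the hypotheses speak
  only about the given \<open>a\<close>.\<close>

lemma qpoch_nonzero_small:
  assumes "norm q < 1" and "norm z < 1"
  shows "qpoch q z k \<noteq> 0" and "qpoch_inf q z \<noteq> 0"
proof -
  have "z * q ^ i \<noteq> 1" for i
  proof
    assume "z * q ^ i = 1"
    then have "norm z * norm q ^ i = 1" by (metis norm_mult norm_one norm_power)
    moreover have "norm z * norm q ^ i \<le> norm z * 1"
      using assms by (intro mult_left_mono power_le_one) auto
    ultimately show False using assms by simp
  qed
  then show "qpoch q z k \<noteq> 0" "qpoch_inf q z \<noteq> 0"
    unfolding qpoch_eq_0_iff qpoch_inf_def
    using prodinf_nonzero[OF qpoch_convergent[OF assms(1), of z]] by auto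
qed

text \<open>For \<open>v = q powi (- int (Suc k)) / u\<close>, peel the last or the first factor off
  \<open>qpoch q v (Suc m)\<close> and compare. Taking \<open>- v\<close> out of both linear factors
  gives the stated form.\<close>

lemma qpoch_shift_down:
  assumes "q \<noteq> 0" "u \<noteq> 0"
  shows "qpoch q (q powi (- int (Suc k)) / u) m * (q ^ m * (1 - q powi (int (Suc k) - int m) * u)) =
         qpoch q (q powi (- int k) / u) m * (1 - q ^ Suc k * u)"
proof -
  define v where "v = q powi (- int (Suc k)) / u"
  have neg: "q powi (- int j) = 1 / q ^ j" for j
    by (simp add: power_int_minus inverse_eq_divide)
  have v: "v * q = q powi (- int k) / u" "v = 1 / (q ^ Suc k * u)"
    using assms unfolding v_def neg by (simp_all add: field_simps)
  have "qpoch q v m * (1 - v * q ^ m) = (1 - v) * qpoch q (v * q) m"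
    using qpoch_Suc[of q v m] qpoch_Suc_left[of q v m] by simp
  moreover have "1 - v * q ^ m = - v * (q ^ m * (1 - q powi (int (Suc k) - int m) * u))"
  proof -
    have "q powi (int (Suc k) - int m) = q ^ Suc k / q ^ m"
      using assms(1) by (simp add: power_int_diff del: of_nat_Suc power_Suc)
    then show ?thesis using assms unfolding v(2) by (simp add: field_simps del: of_nat_Suc)
  qed
  moreover have "1 - v = - v * (1 - q ^ Suc k * u)" "v \<noteq> 0"
    using assms unfolding v(2) by (simp_all add: field_simps)
  ultimately have "- v * (qpoch q v m * (q ^ m * (1 - q powi (int (Suc k) - int m) * u))) =
      - v * (qpoch q (v * q) m * (1 - q ^ Suc k * u))"
    by (simp only: mult.left_commute mult.commute)
  with \<open>v \<noteq> 0\<close> show ?thesis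
    unfolding v(1)[symmetric] v_def[symmetric] by (simp del: of_nat_Suc power_Suc)
qed

section \<open>The summand and its contiguous relation\<close>

text \<open>The algebraic content of nonvanishing denominators: distinct indices have disjoint
  forward orbits under multiplication by \<open>q\<close>, so the nodes of every multi-index are
  distinct, and the last condition covers the diagonal factors \<open>r = s\<close>.\<close>

locale generic_nodes =
  fixes n :: nat and q :: complex and x :: "nat \<Rightarrow> complex"
  assumes q_nz: "q \<noteq> 0"
    and x_nz: "r \<in> {1..n} \<Longrightarrow> x r \<noteq> 0"
    and nodes_distinct: "r \<in> {1..n} \<Longrightarrow> s \<in> {1..n} \<Longrightarrow> r \<noteq> s \<Longrightarrow> x r * q ^ i \<noteq> x s * q ^ j"
    and not_root_of_unity: "q ^ Suc i \<noteq> 1"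
begin

definition node :: "(nat \<Rightarrow> nat) \<Rightarrow> nat \<Rightarrow> complex" where
  "node k r = x r * q ^ k r"

text \<open>The Vandermonde product of the nodes relative to its value at \<open>k = 0\<close>. It
  absorbs the power of \<open>q\<close> whose exponent is the sum of the
  \<open>(r - 1) * k r\<close>.\<close>

definition vd :: "(nat \<Rightarrow> nat) \<Rightarrow> complex" where
  "vd k = (\<Prod>r=1..n. \<Prod>s=Suc r..n. (node k r - node k s) / (x r - x s))"

text \<open>What remains of the summand at \<open>(k, m)\<close> after removing the factors that
  depend on \<open>m\<close> alone and those that see \<open>k\<close> only through its total; in
  particular it is free of \<open>\<alpha>\<close>.\<close>

definition weight :: "(nat \<Rightarrow> nat) \<Rightarrow> (nat \<Rightarrow> nat) \<Rightarrow> (nat \<Rightarrow> nat) \<Rightarrow> complex" where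
  "weight M m k = vd k *
     (\<Prod>r=1..n. \<Prod>s=1..n. qpoch q (q powi (- int (M s)) * x r / x s) (k r)) /
     (\<Prod>r=1..n. \<Prod>s=1..n. qpoch q (q * x r / x s) (k r)) *
     (\<Prod>r=1..n. \<Prod>s=1..n. qpoch q (q powi (- int (k s)) * x r / x s) (m r))"

text \<open>Term \<open>t\<close> of the partial fraction sum at the nodes of \<open>k\<close> with
  parameters \<open>q powi (int (k s) - int (c s))\<close>. Both \<open>c = m\<close> and
  \<open>c = M\<close> will occur.\<close>

definition pf_coeff :: "(nat \<Rightarrow> nat) \<Rightarrow> (nat \<Rightarrow> nat) \<Rightarrow> nat \<Rightarrow> complex" where
  "pf_coeff c k t =
     (\<Prod>s=1..n. 1 - q powi (int (k t) - int (c s)) * x t / x s) /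
     (\<Prod>s\<in>{1..n} - {t}. 1 - node k t / node k s)"

lemma node_nz: "r \<in> {1..n} \<Longrightarrow> node k r \<noteq> 0"
  using x_nz q_nz by (simp add: node_def)

lemma node_neq: "r \<in> {1..n} \<Longrightarrow> s \<in> {1..n} \<Longrightarrow> r \<noteq> s \<Longrightarrow> node k r \<noteq> node l s"
  using nodes_distinct by (simp add: node_def)

lemma x_neq: "r \<in> {1..n} \<Longrightarrow> s \<in> {1..n} \<Longrightarrow> r \<noteq> s \<Longrightarrow> x r \<noteq> x s"
  using nodes_distinct[of r s 0 0] by simp

lemma shift_nz:
  assumes "r \<in> {1..n}" "s \<in> {1..n}"
  shows "1 - q * x r / x s * q ^ i \<noteq> 0"
proof
  assume "1 - q * x r / x s * q ^ i = 0"
  then have *: "x s = x r * q ^ Suc i" using x_nz[OF assms(2)] by (simp add: field_simps)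
  show False
  proof (cases "r = s")
    case True
    then show False using * x_nz[OF assms(2)] not_root_of_unity[of i] by (simp add: mult.commute)
  next
    case False
    then show False using * nodes_distinct[OF assms(2,1), of 0 "Suc i"] by auto
  qed
qed

lemma qpoch_den_nz: "r \<in> {1..n} \<Longrightarrow> s \<in> {1..n} \<Longrightarrow> qpoch q (q * x r / x s) k \<noteq> 0"
  unfolding qpoch_def using shift_nz by (auto simp: prod_zero_iff)

text \<open>The parameters multiply to a single power of \<open>q\<close>, which is why only the
  totals of \<open>k\<close> and \<open>c\<close> survive.\<close>

lemma sum_pf_coeff:
  assumes "n \<ge> 1"
  shows "(\<Sum>t=1..n. pf_coeff c k t) = 1 - q powi (int (total n k) - int (total n c))"
proof -
  have "q powi (int (k t) - int (c s)) * x t / x s = q powi (int (k s) - int (c s)) * node k t / node k s"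
    if "s \<in> {1..n}" for s t
    using q_nz x_nz[OF that] by (simp add: node_def power_int_diff field_simps)
  then have "(\<Sum>t=1..n. pf_coeff c k t) =
      (\<Sum>t=1..n. (\<Prod>s=1..n. 1 - q powi (int (k s) - int (c s)) * node k t / node k s) /
         (\<Prod>s\<in>{1..n} - {t}. 1 - node k t / node k s))"
    by (simp add: pf_coeff_def)
  also have "\<dots> = 1 - (\<Prod>s=1..n. q powi (int (k s) - int (c s)))"
  proof (rule partial_fraction_sum)
    show "inj_on (node k) {1..n}" by (rule inj_onI) (use node_neq in blast)
  qed (use assms node_nz in auto)
  also have "(\<Prod>s=1..n. q powi (int (k s) - int (c s))) = q powi (int (total n k) - int (total n c))"
    using q_nz by (simp add: power_int_diff total_def prod_dividef power_sum del: of_nat_sum)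
  finally show ?thesis .
qed

text \<open>Only differences with node \<open>t\<close> change. Dividing them by the other node,
  which stays fixed, turns them into the denominators of \<open>pf_coeff\<close>; the factor
  \<open>D\<close> removed this way is the same for \<open>k\<close> and \<open>k'\<close>.\<close>

lemma vd_step:
  fixes k :: "nat \<Rightarrow> nat"
  assumes t: "t \<in> {1..n}"
  defines "k' \<equiv> k(t := Suc (k t))"
  shows "vd k' * (\<Prod>s\<in>{1..n} - {t}. 1 - node k t / node k s) =
         vd k * (\<Prod>s\<in>{1..n} - {t}. 1 - node k' t / node k' s)"
proof -
  define D where "D = (\<Prod>s\<in>{1..n} - {t}. - (node k s / (x t - x s)))"
  have frac: "(b - a) / c = - (a / c) * (1 - b / a)" if "a \<noteq> 0" for a b c :: complex
    using that by (cases "c = 0") (simp_all add: field_simps)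
  have sym: "(node l r - node l s) / (x r - x s) = (node l s - node l r) / (x s - x r)" for l r s
    by (metis minus_diff_eq minus_divide_divide)
  have "vd k' * (\<Prod>s\<in>{1..n} - {t}. (node k t - node k s) / (x t - x s)) =
        vd k * (\<Prod>s\<in>{1..n} - {t}. (node k' t - node k' s) / (x t - x s))"
    unfolding vd_def
    by (rule prod_pairs_update[OF t sym sym]) (simp add: k'_def node_def)
  moreover have "(\<Prod>s\<in>{1..n} - {t}. (node k t - node k s) / (x t - x s)) =
      D * (\<Prod>s\<in>{1..n} - {t}. 1 - node k t / node k s)"
    unfolding D_def prod.distrib[symmetric]
    by (rule prod.cong[OF refl], rule frac, rule node_nz, simp)
  moreover have "(\<Prod>s\<in>{1..n} - {t}. (node k' t - node k' s) / (x t - x s)) =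
      D * (\<Prod>s\<in>{1..n} - {t}. 1 - node k' t / node k' s)"
  proof -
    have "D = (\<Prod>s\<in>{1..n} - {t}. - (node k' s / (x t - x s)))"
      unfolding D_def by (rule prod.cong) (auto simp: k'_def node_def)
    then show ?thesis
      unfolding prod.distrib[symmetric] by (simp only: prod.distrib[symmetric])
        (rule prod.cong[OF refl], rule frac, rule node_nz, simp)
  qed
  moreover have "D \<noteq> 0"
    unfolding D_def using node_nz x_neq t by (auto simp: prod_zero_iff)
  ultimately show ?thesis by (simp add: mult.left_commute)
qed

lemma prod_qpoch_step:
  fixes k :: "nat \<Rightarrow> nat"
  assumes t: "t \<in> {1..n}"
  defines "k' \<equiv> k(t := Suc (k t))"
  shows "(\<Prod>r=1..n. \<Prod>s=1..n. qpoch q (w r s) (k' r)) =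
         (\<Prod>r=1..n. \<Prod>s=1..n. qpoch q (w r s) (k r)) * (\<Prod>s=1..n. 1 - w t s * q ^ k t)"
proof -
  have "(\<Prod>r\<in>{1..n} - {t}. \<Prod>s=1..n. qpoch q (w r s) (k' r)) =
        (\<Prod>r\<in>{1..n} - {t}. \<Prod>s=1..n. qpoch q (w r s) (k r))"
    by (intro prod.cong) (auto simp: k'_def)
  moreover have "k' t = Suc (k t)" by (simp add: k'_def)
  ultimately show ?thesis
    using t by (simp add: prod.remove[of "{1..n}" t] qpoch_Suc prod.distrib)
qed

text \<open>Here \<open>k\<close> sits in the bases, so raising \<open>k t\<close> alters column
  \<open>t\<close>, entry by entry through \<open>qpoch_shift_down\<close>. The factor on the right
  is the one that the denominator of \<open>weight\<close> gains, so the two will cancel.\<close>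

lemma prod_lower_step:
  fixes k :: "nat \<Rightarrow> nat"
  assumes t: "t \<in> {1..n}"
  defines "k' \<equiv> k(t := Suc (k t))"
  shows "(\<Prod>r=1..n. \<Prod>s=1..n. qpoch q (q powi (- int (k' s)) * x r / x s) (m r)) *
         (q ^ total n m * (\<Prod>s=1..n. 1 - q powi (int (k' t) - int (m s)) * x t / x s)) =
         (\<Prod>r=1..n. \<Prod>s=1..n. qpoch q (q powi (- int (k s)) * x r / x s) (m r)) *
         (\<Prod>s=1..n. 1 - q * x t / x s * q ^ k t)"
proof -
  let ?F = "\<lambda>l r s. qpoch q (q powi (- int (l s)) * x r / x s) (m r)"
  have row: "?F k' r t * (q ^ m r * (1 - q powi (int (k' t) - int (m r)) * x t / x r)) =
             ?F k r t * (1 - q * x t / x r * q ^ k t)" if "r \<in> {1..n}" for r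
    using qpoch_shift_down[OF q_nz, of "x t / x r" "k t" "m r"] x_nz[OF t] x_nz[OF that]
    by (simp add: k'_def ac_simps)
  have split: "(\<Prod>r=1..n. \<Prod>s=1..n. ?F l r s) =
      (\<Prod>r=1..n. \<Prod>s\<in>{1..n} - {t}. ?F l r s) * (\<Prod>r=1..n. ?F l r t)" for l
    using t by (simp add: prod.remove[of "{1..n}" t] prod.distrib mult.commute)
  have "(\<Prod>r=1..n. \<Prod>s\<in>{1..n} - {t}. ?F k' r s) = (\<Prod>r=1..n. \<Prod>s\<in>{1..n} - {t}. ?F k r s)"
    by (intro prod.cong) (auto simp: k'_def)
  moreover have "(\<Prod>r=1..n. ?F k' r t) *
      (q ^ total n m * (\<Prod>s=1..n. 1 - q powi (int (k' t) - int (m s)) * x t / x s)) =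
      (\<Prod>r=1..n. ?F k r t) * (\<Prod>s=1..n. 1 - q * x t / x s * q ^ k t)"
    unfolding total_def power_sum prod.distrib[symmetric] by (rule prod.cong[OF refl row])
  ultimately show ?thesis unfolding split by (simp add: mult.assoc)
qed

text \<open>The contiguous relation behind the recurrence. From \<open>k\<close> to
  \<open>k'\<close> the upper product gains the numerator of \<open>pf_coeff M k t\<close>, the
  lower product releases that of \<open>pf_coeff m k' t\<close>, the Vandermonde factor exchanges
  their denominators, and \<open>d\<close> cancels.\<close>

lemma weight_step:
  fixes k :: "nat \<Rightarrow> nat"
  assumes t: "t \<in> {1..n}"
  defines "k' \<equiv> k(t := Suc (k t))"
  shows "q ^ total n m * (weight M m k' * pf_coeff m k' t) = weight M m k * pf_coeff M k t"
proof -
  define V V' where "V = (\<Prod>s\<in>{1..n} - {t}. 1 - node k t / node k s)"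
    and "V' = (\<Prod>s\<in>{1..n} - {t}. 1 - node k' t / node k' s)"
  define N where "N l = (\<Prod>r=1..n. \<Prod>s=1..n. qpoch q (q powi (- int (M s)) * x r / x s) (l r))" for l
  define D where "D l = (\<Prod>r=1..n. \<Prod>s=1..n. qpoch q (q * x r / x s) (l r))" for l
  define C where "C l = (\<Prod>r=1..n. \<Prod>s=1..n. qpoch q (q powi (- int (l s)) * x r / x s) (m r))" for l
  define h where "h = (\<Prod>s=1..n. 1 - q powi (int (k t) - int (M s)) * x t / x s)"
  define h' where "h' = (\<Prod>s=1..n. 1 - q powi (int (k' t) - int (m s)) * x t / x s)"
  define d where "d = (\<Prod>s=1..n. 1 - q * x t / x s * q ^ k t)"
  have V: "vd k' * V = vd k * V'" unfolding V_def V'_def k'_def by (rule vd_step[OF t])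
  have nz: "V \<noteq> 0" "V' \<noteq> 0" "d \<noteq> 0" "D k \<noteq> 0"
    unfolding V_def V'_def d_def D_def using node_neq t node_nz shift_nz qpoch_den_nz
    by (auto simp: prod_zero_iff)
  have N: "N k' = N k * h"
  proof -
    have "q powi (int (k t) - int (M s)) * x t / x s = q powi (- int (M s)) * x t / x s * q ^ k t" for s
      using q_nz by (simp add: power_int_diff power_int_minus field_simps)
    moreover have "N k' = N k * (\<Prod>s=1..n. 1 - q powi (- int (M s)) * x t / x s * q ^ k t)"
      unfolding N_def k'_def by (rule prod_qpoch_step[OF t])
    ultimately show ?thesis by (simp only: h_def)
  qed
  have D: "D k' = D k * d" unfolding D_def k'_def d_def by (rule prod_qpoch_step[OF t])
  have C: "C k' * (q ^ total n m * h') = C k * d"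
    unfolding C_def k'_def h'_def d_def by (rule prod_lower_step[OF t])
  have V2: "vd k' / V' = vd k / V" using V nz by (simp add: field_simps)
  have "q ^ total n m * (weight M m k' * pf_coeff m k' t) =
      (vd k' / V') * N k' / D k' * (C k' * (q ^ total n m * h'))"
    unfolding weight_def pf_coeff_def N_def[symmetric] D_def[symmetric] C_def[symmetric]
      V'_def[symmetric] h'_def[symmetric] by (simp add: ac_simps)
  also have "\<dots> = weight M m k * pf_coeff M k t"
    unfolding V2 N D C
    unfolding weight_def pf_coeff_def N_def[symmetric] D_def[symmetric] C_def[symmetric]
      V_def[symmetric] h_def[symmetric] using nz by (simp add: ac_simps)
  finally show ?thesis .
qed

text \<open>The diagonal entry \<open>s = r\<close> contains the factor
  \<open>1 - q powi (- int (k r)) * q ^ k r\<close>. With its counterpart for \<open>M\<close>, this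
  confines the support of the weight, so summation ranges can be enlarged at will.\<close>

lemma weight_eq_0_lower:
  assumes "r \<in> {1..n}" "k r < m r"
  shows "weight M m k = 0"
proof -
  have "qpoch q (q powi (- int (k r)) * x r / x r) (m r) = 0"
    unfolding qpoch_eq_0_iff using assms x_nz[OF assms(1)] q_nz
    by (intro exI[of _ "k r"]) (simp add: power_int_minus)
  from this assms(1) have "(\<Prod>r=1..n. \<Prod>s=1..n. qpoch q (q powi (- int (k s)) * x r / x s) (m r)) = 0"
    by (intro prod_zero bexI[of _ r] finite_atLeastAtMost)
  then show ?thesis by (simp add: weight_def)
qed

lemma weight_eq_0_upper:
  assumes "r \<in> {1..n}" "M r < k r"
  shows "weight M m k = 0"
proof -
  have "qpoch q (q powi (- int (M r)) * x r / x r) (k r) = 0"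
    unfolding qpoch_eq_0_iff using assms x_nz[OF assms(1)] q_nz
    by (intro exI[of _ "M r"]) (simp add: power_int_minus)
  from this assms(1) have "(\<Prod>r=1..n. \<Prod>s=1..n. qpoch q (q powi (- int (M s)) * x r / x s) (k r)) = 0"
    by (intro prod_zero bexI[of _ r] finite_atLeastAtMost)
  then show ?thesis by (simp add: weight_def)
qed

section \<open>Sums of weights over multi-indices of fixed total\<close>

definition level :: "nat \<Rightarrow> (nat \<Rightarrow> nat) set" where
  "level K = {k \<in> multi_indices n. total n k = K}"

definition level_sum :: "(nat \<Rightarrow> nat) \<Rightarrow> (nat \<Rightarrow> nat) \<Rightarrow> nat \<Rightarrow> complex" where
  "level_sum M m K = (\<Sum>k\<in>level K. weight M m k)"

lemma le_total: "r \<in> {1..n} \<Longrightarrow> k r \<le> total n k"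
  unfolding total_def by (intro member_le_sum) auto

lemma total_update:
  assumes "t \<in> {1..n}"
  shows "total n (k(t := Suc (k t))) = Suc (total n k)"
  using assms by (simp add: total_def sum.remove[of "{1..n}" t])

lemma finite_level: "finite (level K)"
proof (rule finite_subset)
  show "level K \<subseteq> {1..n} \<rightarrow>\<^sub>E {0..K}"
  proof
    fix k assume "k \<in> level K"
    then have "k \<in> extensional {1..n}" "total n k = K"
      by (simp_all add: level_def multi_indices_def PiE_def)
    with le_total[of _ k] show "k \<in> {1..n} \<rightarrow>\<^sub>E {0..K}" by (auto simp: PiE_iff)
  qed
qed (simp add: finite_PiE)

text \<open>Both partial fraction sums are inserted into \<^term>\<open>level_sum M m\<close>; they match after
  reindexing because a summand with \<open>k t = 0\<close> either has \<open>m t = 0\<close>, so that its partial fraction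
  coefficient vanishes, or has \<open>k t < m t\<close>, so that its weight does.\<close>

lemma level_sum_step:
  assumes n: "n \<ge> 1"
  shows "q ^ total n m * (1 - q powi (int (Suc K) - int (total n m))) * level_sum M m (Suc K) =
         (1 - q powi (int K - int (total n M))) * level_sum M m K"
proof -
  \<comment> \<open>The index \<open>t\<close> is carried along because the raised multi-index alone
    does not reveal which entry was raised; with it, \<open>up\<close> is injective.\<close>
  define up where "up = (\<lambda>(k, t). (k(t := Suc (k t)), t :: nat))"
  define g where "g = (\<lambda>(k, t). weight M m k * pf_coeff m k t)"
  have pf: "(\<Sum>t=1..n. weight M m k * pf_coeff c k t) =
      (1 - q powi (int L - int (total n c))) * weight M m k" if "k \<in> level L" for c k L
    using that unfolding sum_distrib_left[symmetric] sum_pf_coeff[OF n] by (simp add: level_def)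
  have pf_sum: "(\<Sum>k\<in>level L. \<Sum>t=1..n. weight M m k * pf_coeff c k t) =
      (1 - q powi (int L - int (total n c))) * level_sum M m L" for c L
    unfolding level_sum_def sum_distrib_left[of "1 - _"] by (rule sum.cong[OF refl pf])
  have inj: "inj_on up (level K \<times> {1..n})"
  proof (rule inj_onI)
    fix p p' assume "p \<in> level K \<times> {1..n}" "p' \<in> level K \<times> {1..n}" "up p = up p'"
    then show "p = p'"
      by (auto simp: up_def fun_eq_iff split: prod.splits) (metis Suc_inject)
  qed
  have sub: "up ` (level K \<times> {1..n}) \<subseteq> level (Suc K) \<times> {1..n}"
    using total_update by (auto simp: up_def level_def multi_indices_def PiE_iff extensional_def)
  have zero: "g p = 0" if p: "p \<in> level (Suc K) \<times> {1..n} - up ` (level K \<times> {1..n})" for p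
  proof -
    obtain k t where kt: "p = (k, t)" by fastforce
    have k: "k \<in> level (Suc K)" and t: "t \<in> {1..n}" using p kt by auto
    have "k t = 0"
    proof (rule ccontr)
      assume "k t \<noteq> 0"
      define l where "l = k(t := k t - 1)"
      have kl: "k = l(t := Suc (l t))" using \<open>k t \<noteq> 0\<close> by (simp add: l_def)
      then have "total n l = K" using k total_update[OF t, of l] by (simp add: level_def)
      moreover have "l \<in> multi_indices n"
        using k t by (auto simp: l_def level_def multi_indices_def PiE_iff extensional_def)
      ultimately have "(l, t) \<in> level K \<times> {1..n}" using t by (simp add: level_def)
      moreover have "p = up (l, t)" using kl by (simp add: kt up_def)
      ultimately show False using p by blast
    qed
    show "g p = 0"
    proof (cases "m t = 0")
      case True
      have "(\<Prod>s=1..n. 1 - q powi (int (k t) - int (m s)) * x t / x s) = 0"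
        using t x_nz[OF t] True \<open>k t = 0\<close> by (auto simp: prod_zero_iff intro!: bexI[of _ t])
      then show ?thesis by (simp add: g_def kt pf_coeff_def)
    next
      case False
      then show ?thesis using weight_eq_0_lower[OF t] \<open>k t = 0\<close> by (simp add: g_def kt)
    qed
  qed
  have "q ^ total n m * (1 - q powi (int (Suc K) - int (total n m))) * level_sum M m (Suc K) =
        q ^ total n m * (\<Sum>k\<in>level (Suc K). \<Sum>t=1..n. weight M m k * pf_coeff m k t)"
    by (simp only: pf_sum mult.assoc)
  also have "(\<Sum>k\<in>level (Suc K). \<Sum>t=1..n. weight M m k * pf_coeff m k t) =
      (\<Sum>p\<in>level (Suc K) \<times> {1..n}. g p)"
    by (simp add: g_def sum.cartesian_product)
  also have "\<dots> = (\<Sum>p\<in>up ` (level K \<times> {1..n}). g p)"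
    by (rule sum.mono_neutral_right) (use finite_level sub zero in auto)
  also have "\<dots> = (\<Sum>p\<in>level K \<times> {1..n}. g (up p))"
    by (rule sum.reindex_cong[OF inj]) auto
  \<comment> \<open>On the image of \<open>up\<close>, \<open>weight_step\<close> trades the
    coefficient belonging to \<open>m\<close> for the one belonging to \<open>M\<close>.\<close>
  also have "q ^ total n m * \<dots> = (\<Sum>p\<in>level K \<times> {1..n}. case p of (k, t) \<Rightarrow> weight M m k * pf_coeff M k t)"
    unfolding sum_distrib_left
    using weight_step by (intro sum.cong[OF refl]) (auto simp: g_def up_def)
  also have "\<dots> = (\<Sum>k\<in>level K. \<Sum>t=1..n. weight M m k * pf_coeff M k t)"
    by (simp add: sum.cartesian_product)
  also have "\<dots> = (1 - q powi (int K - int (total n M))) * level_sum M m K"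
    by (rule pf_sum)
  finally show ?thesis .
qed

end

section \<open>Summation over the levels\<close>

text \<open>Up to the constant \<open>q ^ B / q ^ A - 1\<close>, which is nonzero by
  \<open>neq\<close>, the summand is a difference \<open>U (Suc K) - U K\<close>.\<close>

lemma telescoping_level_sums:
  fixes S :: "nat \<Rightarrow> complex" and q \<alpha> :: complex
  assumes q: "q \<noteq> 0" and neq: "q ^ A \<noteq> q ^ B"
    and start: "A = 0 \<or> S 0 = 0" and stop: "S (Suc N) = 0"
    and step: "\<And>K. (q ^ A - q ^ Suc K) * S (Suc K) = (1 - q ^ K / q ^ B) * S K"
    and den: "\<And>K. qpoch q (\<alpha> * q ^ Suc B) K \<noteq> 0"
  shows "(\<Sum>K\<le>N. (1 - \<alpha> * q ^ (2 * K)) * qpoch q \<alpha> (K + A) * q ^ (B * K) /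
            qpoch q (\<alpha> * q ^ Suc B) K * S K) = 0"
proof -
  \<comment> \<open>The factor \<open>(q ^ A - q ^ K) * S K\<close> is there so that the recurrence
    expresses \<open>U (Suc K)\<close> through \<open>S K\<close>. It also makes \<open>U\<close>
    vanish at 0 by \<open>start\<close> and at \<open>Suc N\<close> by \<open>stop\<close>.\<close>
  define U where "U K = q ^ (B * K) * qpoch q \<alpha> (K + A) * (1 - \<alpha> * q ^ B * q ^ K) *
    ((q ^ A - q ^ K) * S K) / (q ^ A * qpoch q (\<alpha> * q ^ Suc B) K)" for K
  have U: "U (Suc K) - U K = (q ^ B / q ^ A - 1) * ((1 - \<alpha> * q ^ (2 * K)) * qpoch q \<alpha> (K + A) *
      q ^ (B * K) / qpoch q (\<alpha> * q ^ Suc B) K * S K)" for K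
  proof -
    define d where "d = qpoch q (\<alpha> * q ^ Suc B) K"
    define p where "p = qpoch q \<alpha> (K + A)"
    define a b c e where "a = q ^ A" and "b = q ^ B" and "c = q ^ K" and "e = q ^ (B * K)"
    have nz: "d \<noteq> 0" "a \<noteq> 0" "b \<noteq> 0" using den q by (simp_all add: d_def a_def b_def)
    have d': "qpoch q (\<alpha> * q ^ Suc B) (Suc K) = d * (1 - \<alpha> * b * q * c)"
      by (simp add: qpoch_Suc d_def b_def c_def mult_ac)
    have nz': "1 - \<alpha> * b * q * c \<noteq> 0" using den[of "Suc K"] unfolding d' by simp
    have p': "qpoch q \<alpha> (Suc K + A) = p * (1 - \<alpha> * c * a)"
      by (simp add: qpoch_Suc p_def a_def c_def power_add mult_ac)
    have "U (Suc K) = e * b * (p * (1 - \<alpha> * c * a)) * (1 - \<alpha> * b * q * c) * ((1 - c / b) * S K) /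
        (a * (d * (1 - \<alpha> * b * q * c)))"
      unfolding U_def d' p' step
      by (simp add: a_def b_def c_def e_def power_add mult_ac)
    also have "\<dots> = e * b * (p * (1 - \<alpha> * c * a)) * ((1 - c / b) * S K) / (a * d)"
      using nz' by simp
    also have "\<dots> = e * (p * (1 - \<alpha> * c * a)) * (b * (1 - c / b) * S K) / (a * d)"
      by (simp add: mult_ac)
    also have "b * (1 - c / b) = b - c" using nz by (simp add: field_simps)
    finally have U1: "U (Suc K) = e * (p * (1 - \<alpha> * c * a)) * ((b - c) * S K) / (a * d)" .
    have U0: "U K = e * p * (1 - \<alpha> * b * c) * ((a - c) * S K) / (a * d)"
      by (simp add: U_def a_def b_def c_def d_def e_def p_def)
    have "U (Suc K) - U K = (e * p * S K) * ((1 - \<alpha> * c * a) * (b - c) - (1 - \<alpha> * b * c) * (a - c)) / (a * d)"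
      unfolding U1 U0 by (simp add: diff_divide_distrib[symmetric] algebra_simps)
    \<comment> \<open>This factorisation is the whole certificate: the very-well-poised factor
      \<open>1 - \<alpha> * q ^ (2 * K)\<close> splits off.\<close>
    also have "(1 - \<alpha> * c * a) * (b - c) - (1 - \<alpha> * b * c) * (a - c) = (b - a) * (1 - \<alpha> * (c * c))"
      by (simp add: algebra_simps)
    also have "(e * p * S K) * \<dots> / (a * d) = (b / a - 1) * ((1 - \<alpha> * (c * c)) * p * e / d * S K)"
      using nz by (simp add: field_simps)
    also have "c * c = q ^ (2 * K)" by (simp add: c_def mult_2 power_add)
    finally show ?thesis by (simp add: a_def b_def d_def e_def p_def)
  qed
  have "(q ^ B / q ^ A - 1) * (\<Sum>K\<le>N. (1 - \<alpha> * q ^ (2 * K)) * qpoch q \<alpha> (K + A) * q ^ (B * K) /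
            qpoch q (\<alpha> * q ^ Suc B) K * S K) = (\<Sum>K<Suc N. U (Suc K) - U K)"
    unfolding sum_distrib_left U by (simp add: lessThan_Suc_atMost)
  also have "\<dots> = U (Suc N) - U 0" by (rule sum_lessThan_telescope)
  also have "\<dots> = 0" using start stop by (auto simp: U_def)
  finally show ?thesis using neq q by simp
qed

text \<open>The contribution of an off-diagonal pair of indices to the diagonal weight. Raising
  \<open>a\<close> by one changes each of the five ingredients by at most a linear factor, and all
  of these cancel up to \<open>1 / q ^ b\<close>.\<close>

lemma qpoch_pair:
  fixes q w y :: complex
  assumes q: "q \<noteq> 0" and w: "w \<noteq> 0" and y: "y \<noteq> 0" and dist: "\<And>i j. w * q ^ i \<noteq> y * q ^ j"
  shows "qpoch q (q powi (- int b) * w / y) a / qpoch q (q * w / y) a *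
         (qpoch q (q powi (- int a) * y / w) b / qpoch q (q * y / w) b) *
         ((w * q ^ a - y * q ^ b) / (w - y)) = 1 / q ^ (a * b)"
proof (induction a)
  case 0
  have ne: "w - y \<noteq> 0" "w \<noteq> y" using dist[of 0 0] by auto
  have "qpoch q (y / w) b * (1 - y / w * q ^ b) = (1 - y / w) * qpoch q (q * y / w) b"
    using qpoch_Suc[of q "y / w" b] qpoch_Suc_left[of q "y / w" b] by (simp add: mult.commute)
  then have "qpoch q (y / w) b * (w - y * q ^ b) = (w - y) * qpoch q (q * y / w) b"
    using w by (simp add: field_simps)
  moreover have "qpoch q (q * y / w) b \<noteq> 0"
    unfolding qpoch_eq_0_iff using dist[of 0 "Suc _"] w by (auto simp: field_simps)
  ultimately show ?case using ne by (simp add: field_simps)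
next
  case (Suc a)
  define u where "u = w / y"
  have u: "u \<noteq> 0" "w = u * y" using w y by (simp_all add: u_def)
  define N D C C' D' where "N = qpoch q (q powi (- int b) * w / y) a"
    and "D = qpoch q (q * w / y) a" and "C = qpoch q (q powi (- int a) * y / w) b"
    and "C' = qpoch q (q powi (- int (Suc a)) * y / w) b" and "D' = qpoch q (q * y / w) b"
  \<comment> \<open>Up to the factor \<open>- y\<close>, these are the node differences before and
    after the step.\<close>
  define g h where "g = q ^ b - q ^ a * u" and "h = q ^ b - q ^ Suc a * u"
  have "q ^ b - q ^ i * u \<noteq> 0" for i
  proof
    assume "q ^ b - q ^ i * u = 0"
    then have "w * q ^ i = y * q ^ b" by (simp add: u(2) mult_ac)
    with dist show False by blast
  qed
  then have gh: "g \<noteq> 0" "h \<noteq> 0" unfolding g_def h_def by blast+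
  have d1: "1 - q ^ Suc a * u \<noteq> 0"
    using dist[of "Suc a" 0] y by (simp add: u_def field_simps)
  have N: "qpoch q (q powi (- int b) * w / y) (Suc a) = N * (g / q ^ b)"
    using q by (simp add: qpoch_Suc N_def g_def u_def power_int_minus field_simps)
  have D: "qpoch q (q * w / y) (Suc a) = D * (1 - q ^ Suc a * u)"
    by (simp add: qpoch_Suc D_def u_def mult_ac)
  have "C' * (q ^ b * (1 - q powi (int (Suc a) - int b) * u)) = C * (1 - q ^ Suc a * u)"
    using qpoch_shift_down[OF q u(1), of a b] by (simp add: C'_def C_def u_def del: of_nat_Suc power_Suc)
  moreover have "q ^ b * (1 - q powi (int (Suc a) - int b) * u) = h"
  proof -
    have "q powi (int (Suc a) - int b) = q ^ Suc a / q ^ b"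
      using q by (simp add: power_int_diff del: of_nat_Suc power_Suc)
    then show ?thesis using q by (simp add: h_def field_simps)
  qed
  ultimately have "C' * h = C * (1 - q ^ Suc a * u)" by (simp only:)
  then have C': "C' = C * (1 - q ^ Suc a * u) / h" by (rule eq_divide_imp[OF gh(2)])
  have L: "w * q ^ a - y * q ^ b = - y * g" "w * q ^ Suc a - y * q ^ b = - y * h"
    by (simp_all add: u(2) g_def h_def algebra_simps)
  have "N * (g / q ^ b) / (D * (1 - q ^ Suc a * u)) * (C * (1 - q ^ Suc a * u) / h / D') * (- y * h / (w - y)) =
      (N / D * (C / D') * (- y * g / (w - y))) / q ^ b"
    using d1 gh by (simp add: divide_simps)
  also have "N / D * (C / D') * (- y * g / (w - y)) = 1 / q ^ (a * b)"
    using Suc.IH unfolding L by (simp add: N_def D_def C_def D'_def)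
  also have "1 / q ^ (a * b) / q ^ b = 1 / q ^ (Suc a * b)"
    by (simp add: power_add mult.commute)
  finally show ?case
    unfolding N D C'_def[symmetric] C' D'_def[symmetric] L .
qed

text \<open>The quotient itself is \<open>(-1) ^ a\<close> times \<open>q\<close> to the power
  \<open>- a * (a + 1) / 2\<close>; squaring removes the sign and the halved exponent.\<close>

lemma qpoch_diagonal:
  fixes q :: complex
  assumes q: "q \<noteq> 0" and nru: "\<And>i. q ^ Suc i \<noteq> 1"
  shows "(qpoch q (q powi (- int a)) a / qpoch q q a)\<^sup>2 * q ^ (a * a) * q ^ a = 1"
proof (induction a)
  case (Suc a)
  define N D where "N = qpoch q (q powi (- int a)) a" and "D = qpoch q q a"
  define p where "p = q ^ Suc a"
  have p: "p \<noteq> 0" "1 - p \<noteq> 0" using q nru[of a] by (auto simp: p_def)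
  have inv: "q powi (- int (Suc a)) = 1 / p"
    by (simp add: p_def power_int_minus inverse_eq_divide del: of_nat_Suc power_Suc)
  have "1 / p * q = q powi (- int a)"
    using q by (simp add: p_def power_int_minus inverse_eq_divide)
  then have "qpoch q (q powi (- int (Suc a))) (Suc a) = (1 - 1 / p) * N"
    unfolding inv qpoch_Suc_left by (simp add: N_def)
  moreover have "qpoch q q (Suc a) = D * (1 - p)" by (simp add: D_def p_def qpoch_Suc)
  moreover have "(1 - 1 / p) * N / (D * (1 - p)) = - (N / D) / p"
    using p by (simp add: divide_simps) (simp add: algebra_simps)
  moreover have "q ^ (Suc a * Suc a) * q ^ Suc a = q ^ (a * a) * q ^ a * (p * p)"
    by (simp add: p_def power_add mult_ac)
  ultimately have "(qpoch q (q powi (- int (Suc a))) (Suc a) / qpoch q q (Suc a))\<^sup>2 *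
      q ^ (Suc a * Suc a) * q ^ Suc a = (N / D)\<^sup>2 * q ^ (a * a) * q ^ a"
    using p by (simp add: power2_eq_square mult.assoc del: power_Suc mult_Suc mult_Suc_right of_nat_Suc)
  then show ?case using Suc.IH by (simp add: N_def D_def)
qed simp

context generic_nodes
begin

section \<open>Vanishing of level sums and summation over boxes\<close>

lemma level_sum_above:
  assumes "total n M < K"
  shows "level_sum M m K = 0"
  unfolding level_sum_def
proof (rule sum.neutral, rule ballI)
  fix k assume "k \<in> level K"
  then have "total n M < total n k" using assms by (simp add: level_def)
  then obtain r where "r \<in> {1..n}" "M r < k r"
    unfolding total_def by (meson not_le sum_mono)
  then show "weight M m k = 0" by (rule weight_eq_0_upper)
qed

lemma level_sum_0:
  assumes "total n m > 0"
  shows "level_sum M m 0 = 0"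
  unfolding level_sum_def
proof (rule sum.neutral, rule ballI)
  fix k assume "k \<in> level 0"
  then have "total n k < total n m" using assms by (simp add: level_def)
  then obtain r where "r \<in> {1..n}" "k r < m r"
    unfolding total_def by (meson not_le sum_mono)
  then show "weight M m k = 0" by (rule weight_eq_0_lower)
qed

definition box :: "(nat \<Rightarrow> nat) \<Rightarrow> (nat \<Rightarrow> nat) set" where
  "box M = (\<Pi>\<^sub>E r\<in>{1..n}. {0..M r})"

lemma finite_box: "finite (box M)"
  by (simp add: box_def finite_PiE)

lemma box_eqI:
  assumes "k \<in> box M" "M \<in> box M" "\<And>r. r \<in> {1..n} \<Longrightarrow> M r \<le> k r"
  shows "k = M"
proof (rule PiE_ext)
  show "k \<in> {1..n} \<rightarrow>\<^sub>E UNIV" "M \<in> {1..n} \<rightarrow>\<^sub>E UNIV" using assms by (auto simp: box_def PiE_iff)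
  show "k r = M r" if "r \<in> {1..n}" for r
    using assms that by (force simp: box_def PiE_iff)
qed

text \<open>A level may stick out of the box, but the weight vanishes there, so complete levels can
  be used.\<close>

lemma sum_box_by_levels:
  "(\<Sum>k\<in>box M. c (total n k) * weight M m k) = (\<Sum>K\<le>total n M. c K * level_sum M m K)"
proof -
  have le: "total n k \<le> total n M" if "k \<in> box M" for k
    using that unfolding total_def box_def by (intro sum_mono) (auto simp: PiE_iff)
  have "(\<Sum>k\<in>box M. c (total n k) * weight M m k) =
      (\<Sum>K\<le>total n M. \<Sum>k\<in>{k\<in>box M. total n k = K}. c (total n k) * weight M m k)"
    by (rule sum.group[symmetric]) (use finite_box le in auto)
  also have "\<dots> = (\<Sum>K\<le>total n M. c K * level_sum M m K)"
  proof (rule sum.cong[OF refl])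
    fix K
    have "(\<Sum>k\<in>{k\<in>box M. total n k = K}. c (total n k) * weight M m k) = (\<Sum>k\<in>level K. c K * weight M m k)"
    proof (rule sum.mono_neutral_cong_left[OF finite_level])
      show "{k \<in> box M. total n k = K} \<subseteq> level K"
        by (auto simp: box_def level_def multi_indices_def PiE_iff)
      show "\<forall>k\<in>level K - {k \<in> box M. total n k = K}. c K * weight M m k = 0"
      proof
        fix k assume k: "k \<in> level K - {k \<in> box M. total n k = K}"
        then obtain r where "r \<in> {1..n}" "M r < k r"
          by (auto simp: box_def level_def multi_indices_def PiE_iff not_le)
        then show "c K * weight M m k = 0" by (simp add: weight_eq_0_upper)
      qed
    qed auto
    then show "(\<Sum>k\<in>{k\<in>box M. total n k = K}. c (total n k) * weight M m k) = c K * level_sum M m K"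
      by (simp add: level_sum_def sum_distrib_left)
  qed
  finally show ?thesis .
qed

text \<open>Being in the box and different from \<open>M\<close> forces a strictly smaller total.
  Since \<open>q\<close> is not a root of unity, the two powers of \<open>q\<close> differ, as
  telescoping requires.\<close>

lemma sum_box_eq_0:
  assumes n: "n \<ge> 1" and m: "m \<in> box M" "m \<noteq> M" and M: "M \<in> box M"
    and den: "\<And>K. qpoch q (\<alpha> * q ^ Suc (total n M)) K \<noteq> 0"
  shows "(\<Sum>k\<in>box M. (1 - \<alpha> * q ^ (2 * total n k)) * qpoch q \<alpha> (total n k + total n m) *
            q ^ (total n M * total n k) / qpoch q (\<alpha> * q ^ Suc (total n M)) (total n k) *
            weight M m k) = 0"
proof -
  let ?A = "total n m" and ?B = "total n M"
  have le: "m r \<le> M r" if "r \<in> {1..n}" for r using m that by (auto simp: box_def PiE_iff)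
  have "\<exists>r\<in>{1..n}. m r < M r"
    using box_eqI[OF m(1) M] m(2) by (meson not_le)
  then have lt: "?A < ?B" unfolding total_def using le by (intro sum_strict_mono_ex1) auto
  have neq: "q ^ ?A \<noteq> q ^ ?B"
  proof
    assume "q ^ ?A = q ^ ?B"
    moreover obtain d where "?B = ?A + Suc d" using lt less_iff_Suc_add by auto
    ultimately show False using q_nz not_root_of_unity[of d] by (simp add: power_add)
  qed
  show ?thesis
    unfolding sum_box_by_levels[where c = "\<lambda>K. (1 - \<alpha> * q ^ (2 * K)) * qpoch q \<alpha> (K + ?A) *
            q ^ (?B * K) / qpoch q (\<alpha> * q ^ Suc ?B) K"]
  proof (rule telescoping_level_sums[OF q_nz neq _ _ _ den])
    show "?A = 0 \<or> level_sum M m 0 = 0" using level_sum_0 by auto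
    show "level_sum M m (Suc ?B) = 0" by (rule level_sum_above) simp
    fix K
    have "q ^ ?A * (1 - q powi (int (Suc K) - int ?A)) = q ^ ?A - q ^ Suc K"
      using q_nz by (simp add: power_int_diff algebra_simps del: of_nat_Suc power_Suc)
    moreover have "1 - q powi (int K - int ?B) = 1 - q ^ K / q ^ ?B"
      using q_nz by (simp add: power_int_diff)
    ultimately show "(q ^ ?A - q ^ Suc K) * level_sum M m (Suc K) =
        (1 - q ^ K / q ^ ?B) * level_sum M m K"
      using level_sum_step[OF n, of m K M] by (simp only:)
  qed
qed

text \<open>For \<open>m = M\<close> the lower cutoff \<open>M \<le> k\<close> meets the box in a
  single point.\<close>

lemma sum_box_diagonal:
  assumes M: "M \<in> box M"
  shows "(\<Sum>k\<in>box M. c k * weight M M k) = c M * weight M M M"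
proof -
  have "(\<Sum>k\<in>box M. c k * weight M M k) = (\<Sum>k\<in>{M}. c k * weight M M k)"
  proof (rule sum.mono_neutral_right)
    show "\<forall>k\<in>box M - {M}. c k * weight M M k = 0"
    proof
      fix k assume "k \<in> box M - {M}"
      then obtain r where "r \<in> {1..n}" "k r < M r"
        using box_eqI[OF _ M] by (metis DiffD1 DiffD2 insertI1 not_le)
      then show "c k * weight M M k = 0" by (simp add: weight_eq_0_lower)
    qed
  qed (use M finite_box in auto)
  then show ?thesis by simp
qed

text \<open>At \<open>k = m = M\<close> the two numerator products coincide, so the left side is the
  square of one expression \<open>E\<close> times powers of \<open>q\<close>. In \<open>E\<close>
  every pair collapses by \<open>qpoch_pair\<close> and every diagonal entry is handled by
  \<open>qpoch_diagonal\<close>.\<close>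

lemma diagonal_weight:
  "weight M M M * (vd M / (\<Prod>r=1..n. \<Prod>s=1..n. qpoch q (q * x r / x s) (M r))) *
     q ^ (total n M * total n M) * q ^ total n M = 1"
proof -
  define F where "F r s = qpoch q (q powi (- int (M s)) * x r / x s) (M r) / qpoch q (q * x r / x s) (M r)" for r s
  define E where "E = vd M * (\<Prod>r=1..n. \<Prod>s=1..n. F r s)"
  have pair: "(node M r - node M s) / (x r - x s) * (F r s * F s r) = 1 / q ^ (M r * M s)"
    if "r \<in> {1..n}" "s \<in> {Suc r..n}" for r s
    using qpoch_pair[OF q_nz x_nz x_nz nodes_distinct, of r s "M s" "M r"] that
    by (simp add: F_def node_def mult.commute)
  have "E = (\<Prod>r=1..n. F r r) * (\<Prod>r=1..n. \<Prod>s=Suc r..n. (node M r - node M s) / (x r - x s) * (F r s * F s r))"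
    unfolding E_def vd_def prod_pairs_split[of F] by (simp only: prod.distrib mult_ac)
  also have "(\<Prod>r=1..n. \<Prod>s=Suc r..n. (node M r - node M s) / (x r - x s) * (F r s * F s r)) =
      1 / (\<Prod>r=1..n. \<Prod>s=Suc r..n. q ^ (M r * M s))"
  proof -
    have "(\<Prod>r=1..n. \<Prod>s=Suc r..n. (node M r - node M s) / (x r - x s) * (F r s * F s r)) =
        (\<Prod>r=1..n. \<Prod>s=Suc r..n. 1 / q ^ (M r * M s))"
      by (intro prod.cong refl pair)
    then show ?thesis by (simp add: prod_dividef)
  qed
  finally have E: "E = (\<Prod>r=1..n. F r r) / (\<Prod>r=1..n. \<Prod>s=Suc r..n. q ^ (M r * M s))" by simp
  \<comment> \<open>Expanding the square of the total produces every off-diagonal power twice, which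
    matches the squared pair factors of \<open>E\<close>.\<close>
  have "q ^ (total n M * total n M) = (\<Prod>r=1..n. \<Prod>s=1..n. q ^ (M r * M s))"
    by (simp add: total_def sum_product power_sum)
  also have "\<dots> = (\<Prod>r=1..n. q ^ (M r * M r)) * (\<Prod>r=1..n. \<Prod>s=Suc r..n. q ^ (M r * M s))\<^sup>2"
    unfolding prod_pairs_split[of "\<lambda>r s. q ^ (M r * M s)"]
    by (simp add: power2_eq_square prod.distrib[symmetric] mult.commute)
  finally have Q: "q ^ (total n M * total n M) =
      (\<Prod>r=1..n. q ^ (M r * M r)) * (\<Prod>r=1..n. \<Prod>s=Suc r..n. q ^ (M r * M s))\<^sup>2" .
  have nz: "(\<Prod>r=1..n. \<Prod>s=Suc r..n. q ^ (M r * M s)) \<noteq> 0"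
    using q_nz by (simp add: prod_zero_iff)
  have "weight M M M * (vd M / (\<Prod>r=1..n. \<Prod>s=1..n. qpoch q (q * x r / x s) (M r))) = E\<^sup>2"
    by (simp add: weight_def E_def F_def prod_dividef power2_eq_square mult_ac)
  moreover have "E\<^sup>2 * q ^ (total n M * total n M) =
      (\<Prod>r=1..n. F r r)\<^sup>2 * (\<Prod>r=1..n. q ^ (M r * M r))"
  proof -
    have "(c / d)\<^sup>2 * (e * d\<^sup>2) = c\<^sup>2 * e" if "d \<noteq> 0" for c d e :: complex
      using that by (simp add: power_divide)
    from this[OF nz] show ?thesis unfolding E Q .
  qed
  moreover have "(\<Prod>r=1..n. F r r)\<^sup>2 * (\<Prod>r=1..n. q ^ (M r * M r)) * q ^ total n M =
      (\<Prod>r=1..n. (F r r)\<^sup>2 * q ^ (M r * M r) * q ^ M r)"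
    by (simp add: total_def power_sum prod.distrib prod_power_distrib)
  moreover have "\<dots> = 1"
  proof (rule prod.neutral, rule ballI)
    fix r assume "r \<in> {1..n}"
    then have "F r r = qpoch q (q powi (- int (M r))) (M r) / qpoch q q (M r)"
      using x_nz[of r] by (simp add: F_def)
    then show "(F r r)\<^sup>2 * q ^ (M r * M r) * q ^ M r = 1"
      using qpoch_diagonal[OF q_nz not_root_of_unity, of "M r"] by simp
  qed
  ultimately show ?thesis by simp
qed

section \<open>The terminating case\<close>

text \<open>Each pair \<open>r < s\<close> needs one factor \<open>q ^ k s\<close> to become a
  quotient of node differences, and \<open>s\<close> is the larger index of exactly
  \<open>s - 1\<close> pairs.\<close>

lemma vandermonde_ratio_eq:
  "vandermonde_ratio n q x k * q ^ (\<Sum>r=1..n. (r - 1) * k r) = vd k"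
proof -
  have "q ^ (\<Sum>r=1..n. (r - 1) * k r) = (\<Prod>s=1..n. (q ^ k s) ^ (s - 1))"
    by (simp add: power_sum power_mult[symmetric] mult.commute)
  also have "\<dots> = (\<Prod>r=1..n. \<Prod>s=Suc r..n. q ^ k s)"
    by (rule prod_pairs_snd[symmetric])
  finally have "vandermonde_ratio n q x k * q ^ (\<Sum>r=1..n. (r - 1) * k r) =
      (\<Prod>r=1..n. \<Prod>s=Suc r..n. (1 - q powi (int (k r) - int (k s)) * (x r / x s)) / (1 - x r / x s) * q ^ k s)"
    by (simp only: vandermonde_ratio_def prod.distrib)
  also have "\<dots> = vd k"
    unfolding vd_def
  proof (intro prod.cong refl)
    fix r s assume "r \<in> {1..n}" "s \<in> {Suc r..n}"
    then have s: "x s \<noteq> 0" and ne: "x r - x s \<noteq> 0" using x_nz[of s] x_neq[of r s] by auto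
    have "(1 - q powi (int (k r) - int (k s)) * (x r / x s)) * q ^ k s = - (node k r - node k s) / x s"
      using q_nz s by (simp add: node_def power_int_diff field_simps)
    moreover have "1 - x r / x s = - (x r - x s) / x s" using s by (simp add: field_simps)
    ultimately show "(1 - q powi (int (k r) - int (k s)) * (x r / x s)) / (1 - x r / x s) * q ^ k s =
        (node k r - node k s) / (x r - x s)"
      using s ne by (simp only: times_divide_eq_left) (simp add: divide_simps, simp add: algebra_simps)
  qed
  finally show ?thesis .
qed

text \<open>Writing the exponent as \<open>Suc (M s)\<close> absorbs the leading \<open>q\<close> of
  each base.\<close>

lemma numerator_power:
  assumes a: "\<And>s. s \<in> {1..n} \<Longrightarrow> a s = q ^ Suc (M s)"
  shows "numerator n q x k a =
    (\<Prod>r=1..n. \<Prod>s=1..n. qpoch q (q powi (- int (M s)) * x r / x s) (k r)) *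
    q ^ ((total n M + n) * total n k)"
proof -
  have nz: "\<forall>s\<in>{1..n}. a s \<noteq> 0" using a q_nz by simp
  have "q * x r / (x s * a s) = q powi (- int (M s)) * x r / x s" if "s \<in> {1..n}" for r s
    using q_nz by (simp add: a[OF that] power_int_minus field_simps)
  moreover have "(\<Prod>s=1..n. a s) = q ^ (total n M + n)"
    using a by (simp add: total_def power_sum power_add prod.distrib mult.commute)
  ultimately show ?thesis
    using nz by (simp add: numerator_def numerator_raw_def power_mult)
qed

lemma outer_term_eq_0:
  assumes a: "\<And>s. s \<in> {1..n} \<Longrightarrow> a s = q ^ Suc (M s)"
    and k: "k \<in> multi_indices n - box M"
  shows "outer_term n q \<alpha> b x f a k = 0"
proof -
  obtain r where r: "r \<in> {1..n}" "M r < k r"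
    using k by (auto simp: box_def multi_indices_def PiE_iff not_le)
  have "qpoch q (q powi (- int (M r)) * x r / x r) (k r) = 0"
    unfolding qpoch_eq_0_iff using r x_nz[OF r(1)] q_nz
    by (intro exI[of _ "M r"]) (simp add: power_int_minus)
  from this r(1) have "(\<Prod>r=1..n. \<Prod>s=1..n. qpoch q (q powi (- int (M s)) * x r / x s) (k r)) = 0"
    by (intro prod_zero bexI[of _ r] finite_atLeastAtMost)
  then have "numerator n q x k a = 0" by (simp only: numerator_power[OF a] mult_zero_left)
  then show ?thesis by (simp add: outer_term_def)
qed

text \<open>Collects all factors constant in \<open>k\<close>, to be pulled out once the sums are
  exchanged.\<close>

definition inner_coeff ::
  "complex \<Rightarrow> complex \<Rightarrow> ((nat \<Rightarrow> complex) \<Rightarrow> complex) \<Rightarrow> (nat \<Rightarrow> nat) \<Rightarrow> complex" where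
  "inner_coeff \<alpha> b f m = vd m * q ^ total n m / (\<Prod>r=1..n. \<Prod>s=1..n. qpoch q (q * x r / x s) (m r)) /
     qpoch q (\<alpha> * b) (total n m) * f (\<lambda>r\<in>{1..n}. \<alpha> * q ^ (1 + m r)) / (1 - \<alpha>)"

text \<open>Prepares the exchange of sums: the inner range grows from \<open>m \<le> k\<close> to a
  box independent of \<open>k\<close>, and the two factorials with base \<open>\<alpha>\<close> and
  \<open>\<alpha> * q ^ K\<close> fuse by \<open>qpoch_add\<close>.\<close>

lemma outer_term_box:
  assumes a: "\<And>s. s \<in> {1..n} \<Longrightarrow> a s = q ^ Suc (M s)" and k: "k \<in> box M"
    and A: "\<alpha> * (\<Prod>s=1..n. a s) * q powi (1 - int n) = \<alpha> * q ^ Suc (total n M)"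
  shows "outer_term n q \<alpha> b x f a k =
    (\<Sum>m\<in>box M. inner_coeff \<alpha> b f m * ((1 - \<alpha> * q ^ (2 * total n k)) * qpoch q \<alpha> (total n k + total n m) *
            q ^ (total n M * total n k) / qpoch q (\<alpha> * q ^ Suc (total n M)) (total n k) *
            weight M m k))"
    (is "_ = (\<Sum>m\<in>box M. ?T m)")
proof -
  define N where "N = (\<Prod>r=1..n. \<Prod>s=1..n. qpoch q (q powi (- int (M s)) * x r / x s) (k r))"
  define D where "D l = (\<Prod>r=1..n. \<Prod>s=1..n. qpoch q (q * x r / x s) (l r))" for l
  define C where "C m = (\<Prod>r=1..n. \<Prod>s=1..n. qpoch q (q powi (- int (k s)) * x r / x s) (m r))" for m
  define e where "e l = (\<Sum>r=1..n. (r - 1) * l r)" for l :: "nat \<Rightarrow> nat"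
  define K where "K = total n k"
  define P where "P = (1 - \<alpha> * q ^ (2 * K)) * qpoch q \<alpha> K / ((1 - \<alpha>) * qpoch q (\<alpha> * q ^ Suc (total n M)) K)"
  have num: "numerator n q x k a = N * q ^ ((total n M + n) * K)"
    unfolding N_def K_def by (rule numerator_power) (rule a)
  have outer: "outer_term n q \<alpha> b x f a k = vd k * N / D k * P * q ^ (total n M * K) * inner_sum n q \<alpha> b x f k"
  proof -
    \<comment> \<open>The negative power in the summand removes the \<open>n\<close> that came from
      the shift by one in the exponents of the \<open>a s\<close>.\<close>
    have "q ^ ((total n M + n) * K) * q powi (int (e k) - int (n * K)) = q ^ e k * q ^ (total n M * K)"
    proof -
      have "q powi (int (e k) - int (n * K)) = q ^ e k / q ^ (n * K)"
        using q_nz by (simp add: power_int_diff del: of_nat_mult)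
      then show ?thesis using q_nz by (simp add: add_mult_distrib power_add)
    qed
    moreover have "outer_term n q \<alpha> b x f a k = vandermonde_ratio n q x k * (N / D k) * P *
        (q ^ ((total n M + n) * K) * q powi (int (e k) - int (n * K))) * inner_sum n q \<alpha> b x f k"
      unfolding outer_term_def num A
      by (simp add: N_def D_def P_def K_def e_def mult_ac)
    ultimately show ?thesis
      using vandermonde_ratio_eq[of k] by (simp add: e_def mult_ac)
  qed
  have inner: "inner_sum n q \<alpha> b x f k = (\<Sum>m\<in>box k. vd m * q ^ total n m * (C m / D m) *
      (qpoch q (\<alpha> * q ^ K) (total n m) / qpoch q (\<alpha> * b) (total n m)) *
      f (\<lambda>r\<in>{1..n}. \<alpha> * q ^ (1 + m r)))"
    unfolding inner_sum_def box_def[symmetric]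
  proof (rule sum.cong[OF refl])
    fix m
    \<comment> \<open>Truncated subtraction in \<open>e\<close> is harmless since \<open>r\<close>
      starts at 1.\<close>
    have "(\<Sum>r=1..n. r * m r) = e m + total n m"
      unfolding e_def total_def sum.distrib[symmetric]
      by (rule sum.cong) (auto simp: algebra_simps mult_eq_if)
    then have "vandermonde_ratio n q x m * q ^ (\<Sum>r=1..n. r * m r) = vd m * q ^ total n m"
      using vandermonde_ratio_eq[of m] by (simp add: power_add e_def mult_ac)
    then show "vandermonde_ratio n q x m *
        (\<Prod>r=1..n. \<Prod>s=1..n. qpoch q (q powi (- int (k s)) * x r / x s) (m r) / qpoch q (q * x r / x s) (m r)) *
        (qpoch q (\<alpha> * q ^ total n k) (total n m) / qpoch q (\<alpha> * b) (total n m)) *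
        q ^ (\<Sum>r=1..n. r * m r) * f (\<lambda>r\<in>{1..n}. \<alpha> * q ^ (1 + m r)) =
      vd m * q ^ total n m * (C m / D m) *
      (qpoch q (\<alpha> * q ^ K) (total n m) / qpoch q (\<alpha> * b) (total n m)) *
      f (\<lambda>r\<in>{1..n}. \<alpha> * q ^ (1 + m r))"
      by (simp add: prod_dividef C_def D_def K_def mult_ac)
  qed
  have T: "vd k * N / D k * P * q ^ (total n M * K) * (vd m * q ^ total n m * (C m / D m) *
      (qpoch q (\<alpha> * q ^ K) (total n m) / qpoch q (\<alpha> * b) (total n m)) *
      f (\<lambda>r\<in>{1..n}. \<alpha> * q ^ (1 + m r))) = ?T m" for m
    unfolding inner_coeff_def weight_def N_def[symmetric] D_def[symmetric] C_def[symmetric] K_def[symmetric]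
      qpoch_add P_def by (simp add: mult_ac)
  have "outer_term n q \<alpha> b x f a k = (\<Sum>m\<in>box k. ?T m)"
    unfolding outer inner sum_distrib_left T ..
  also have "\<dots> = (\<Sum>m\<in>box M. ?T m)"
  proof (rule sum.mono_neutral_left[OF finite_box])
    show "box k \<subseteq> box M" using k by (fastforce simp: box_def PiE_iff)
    show "\<forall>m\<in>box M - box k. ?T m = 0"
    proof
      fix m assume "m \<in> box M - box k"
      then obtain r where "r \<in> {1..n}" "k r < m r" by (auto simp: box_def PiE_iff not_le)
      then show "?T m = 0" by (simp add: weight_eq_0_lower)
    qed
  qed
  finally show ?thesis .
qed

lemma terminating_case:
  assumes n: "n \<ge> 1" and q1: "norm q < 1"
    and a: "\<And>r. r \<in> {1..n} \<Longrightarrow> N r > 0 \<and> a r = q ^ N r"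
    and \<alpha>: "1 - \<alpha> \<noteq> 0"
    and den: "\<And>k. qpoch q (\<alpha> * (\<Prod>s=1..n. a s) * q powi (1 - int n)) k \<noteq> 0"
    and den_b: "qpoch_inf q (\<alpha> * b) \<noteq> 0"
    and den_inf: "qpoch_inf q (\<alpha> * (\<Prod>s=1..n. a s) * q powi (1 - int n)) \<noteq> 0"
  shows "(outer_term n q \<alpha> b x f a has_sum lhs n q \<alpha> b f a) (multi_indices n)"
proof -
  \<comment> \<open>Positivity of \<open>N r\<close> gives \<open>a r = q ^ Suc (M r)\<close>; the
    restriction makes \<open>M\<close> an element of its own box.\<close>
  define M where "M = (\<lambda>r\<in>{1..n}. N r - 1)"
  define B where "B = total n M"
  have MM: "M \<in> box M" by (auto simp: box_def M_def)
  have aM: "a s = q ^ Suc (M s)" if "s \<in> {1..n}" for s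
    using a[OF that] that by (simp add: M_def del: power_Suc)
  have prod_a: "(\<Prod>s=1..n. a s) = q ^ (B + n)"
    using aM by (simp add: B_def total_def power_sum power_add prod.distrib mult.commute)
  have A: "\<alpha> * (\<Prod>s=1..n. a s) * q powi (1 - int n) = \<alpha> * q ^ Suc B"
    using q_nz by (simp add: prod_a power_int_diff power_add)
  have A': "\<alpha> * (\<Prod>s=1..n. a s) * b / q ^ n = \<alpha> * b * q ^ B"
    using q_nz by (simp add: prod_a power_add)
  note den = den[unfolded A] and den_inf = den_inf[unfolded A]
  let ?w = "\<lambda>k m. (1 - \<alpha> * q ^ (2 * total n k)) * qpoch q \<alpha> (total n k + total n m) *
            q ^ (B * total n k) / qpoch q (\<alpha> * q ^ Suc B) (total n k)"
  have "(\<Sum>k\<in>box M. outer_term n q \<alpha> b x f a k) =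
      (\<Sum>k\<in>box M. \<Sum>m\<in>box M. inner_coeff \<alpha> b f m * (?w k m * weight M m k))"
    unfolding B_def by (intro sum.cong refl outer_term_box aM A[unfolded B_def])
  also have "\<dots> = (\<Sum>m\<in>box M. inner_coeff \<alpha> b f m * (\<Sum>k\<in>box M. ?w k m * weight M m k))"
    by (subst sum.swap) (simp add: sum_distrib_left)
  also have "\<dots> = (\<Sum>m\<in>{M}. inner_coeff \<alpha> b f m * (\<Sum>k\<in>box M. ?w k m * weight M m k))"
  proof (rule sum.mono_neutral_right[OF finite_box])
    show "{M} \<subseteq> box M" using MM by simp
    show "\<forall>m\<in>box M - {M}. inner_coeff \<alpha> b f m * (\<Sum>k\<in>box M. ?w k m * weight M m k) = 0"
      using sum_box_eq_0[OF n _ _ MM den[unfolded B_def]] unfolding B_def by simp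
  qed
  also have "\<dots> = inner_coeff \<alpha> b f M * (?w M M * weight M M M)"
    using sum_box_diagonal[OF MM, of "\<lambda>k. ?w k M"] by simp
  also have "\<dots> = lhs n q \<alpha> b f a"
  proof -
    define D where "D = (\<Prod>r=1..n. \<Prod>s=1..n. qpoch q (q * x r / x s) (M r))"
    define F where "F = f (\<lambda>r\<in>{1..n}. \<alpha> * q ^ (1 + M r))"
    have fa: "f (\<lambda>r\<in>{1..n}. \<alpha> * a r) = F"
      unfolding F_def using aM by (intro arg_cong[of _ _ f] restrict_ext) (simp add: power_add)
    have den_b': "qpoch q (\<alpha> * b) B \<noteq> 0" "qpoch_inf q (\<alpha> * b * q ^ B) \<noteq> 0"
      using den_b unfolding qpoch_inf_split[OF q1, of "\<alpha> * b" B] by auto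
    \<comment> \<open>At \<open>k = m = M\<close> the very-well-poised factor is exactly the next
      factor of \<open>qpoch q \<alpha> (B + B)\<close>, and the completed product splits into
      three.\<close>
    have "qpoch q \<alpha> (Suc (B + B)) = (1 - \<alpha>) * (qpoch q (\<alpha> * q) B * qpoch q (\<alpha> * q ^ Suc B) B)"
      unfolding qpoch_Suc_left qpoch_add by (simp add: mult.assoc)
    then have w: "(1 - \<alpha> * q ^ (2 * B)) * qpoch q \<alpha> (B + B) =
        (1 - \<alpha>) * (qpoch q (\<alpha> * q) B * qpoch q (\<alpha> * q ^ Suc B) B)"
      unfolding mult_2 by (simp add: qpoch_Suc mult.commute)
    have "inner_coeff \<alpha> b f M * (?w M M * weight M M M) =
        (weight M M M * (vd M / D) * q ^ (B * B) * q ^ B) *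
        ((1 - \<alpha> * q ^ (2 * B)) * qpoch q \<alpha> (B + B)) /
        ((1 - \<alpha>) * qpoch q (\<alpha> * q ^ Suc B) B) * F / qpoch q (\<alpha> * b) B"
      unfolding inner_coeff_def D_def[symmetric] F_def[symmetric] B_def[symmetric] by (simp add: mult_ac)
    also have "\<dots> = qpoch q (\<alpha> * q) B * F / qpoch q (\<alpha> * b) B"
      unfolding w using \<alpha> den[of B] diagonal_weight[of M, folded B_def D_def] by simp
    also have "\<dots> = lhs n q \<alpha> b f a"
    proof -
      \<comment> \<open>The quotients of infinite products in \<open>lhs\<close> reduce to finite
        factorials of length \<open>B\<close>.\<close>
      have s1: "qpoch_inf q (\<alpha> * q) = qpoch q (\<alpha> * q) B * qpoch_inf q (\<alpha> * q ^ Suc B)"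
        using qpoch_inf_split[OF q1, of "\<alpha> * q" B] by (simp add: mult.assoc)
      show ?thesis
        unfolding lhs_def fa A A' s1 qpoch_inf_split[OF q1, of "\<alpha> * b" B]
        using den_b' den_inf by (simp add: field_simps)
    qed
    finally show ?thesis .
  qed
  finally have sum: "(\<Sum>k\<in>box M. outer_term n q \<alpha> b x f a k) = lhs n q \<alpha> b f a" .
  have "(outer_term n q \<alpha> b x f a has_sum lhs n q \<alpha> b f a) (box M)"
    unfolding sum[symmetric] by (rule has_sum_finite[OF finite_box])
  moreover have "box M \<subseteq> multi_indices n" by (auto simp: box_def multi_indices_def PiE_iff)
  moreover have "outer_term n q \<alpha> b x f a k = 0" if "k \<in> multi_indices n - box M" for k
    by (rule outer_term_eq_0) (use aM that in auto)
  ultimately show ?thesis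
    by (subst has_sum_cong_neutral[where T = "box M"]) auto
qed

end

section \<open>The identity theorem on a polydisc\<close>

text \<open>Around a centre with the same frozen coordinates, every monomial involving a variable
  other than \<open>j\<close> vanishes, which leaves a power series in one variable.\<close>

lemma analytic_in_variables_slice:
  assumes F: "analytic_in_variables n F (polydisc n R)" and p: "p \<in> polydisc n R" and j: "j \<in> {1..n}"
  shows "(\<lambda>z. F (p(j := z))) holomorphic_on ball 0 R"
  unfolding holomorphic_on_def
proof
  fix z0 :: complex assume z0: "z0 \<in> ball 0 R"
  define p' where "p' = p(j := z0)"
  have "p' \<in> polydisc n R" using p z0 by (auto simp: p'_def polydisc_def)
  then obtain \<epsilon> c where \<epsilon>: "\<epsilon> > 0" and
    c: "\<And>a. (\<forall>r\<in>{1..n}. dist (a r) (p' r) < \<epsilon>) \<Longrightarrow>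
        ((\<lambda>k. c k * (\<Prod>r=1..n. (a r - p' r) ^ k r)) has_sum F a) (multi_indices n)"
    using F unfolding analytic_in_variables_def by meson
  define e where "e i = (\<lambda>r\<in>{1..n}. if r = j then i else 0 :: nat)" for i
  have inj: "inj e" using j by (auto simp: inj_def e_def fun_eq_iff restrict_def split: if_splits)
  have sums: "(\<lambda>i. c (e i) * (z - z0) ^ i) sums F (p(j := z))" if z: "z \<in> ball z0 \<epsilon>" for z
  proof -
    let ?a = "p(j := z)" and ?t = "\<lambda>k. c k * (\<Prod>r=1..n. ((p(j := z)) r - p' r) ^ k r)"
    have "(?t has_sum F ?a) (multi_indices n)"
      by (rule c) (use z \<epsilon> in \<open>auto simp: p'_def dist_commute\<close>)
    moreover have "?t k = 0" if k: "k \<in> multi_indices n - range e" for k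
    proof -
      have "\<exists>r\<in>{1..n}. r \<noteq> j \<and> k r \<noteq> 0"
      proof (rule ccontr)
        assume "\<not> ?thesis"
        then have "k = e (k j)"
          using k by (auto simp: e_def fun_eq_iff multi_indices_def PiE_iff extensional_def)
        then show False using k by blast
      qed
      then obtain r where r: "r \<in> {1..n}" "r \<noteq> j" "k r \<noteq> 0" by blast
      have "(\<Prod>r=1..n. ((p(j := z)) r - p' r) ^ k r) = 0"
        by (rule prod_zero[OF _ bexI[OF _ r(1)]]) (use r in \<open>auto simp: p'_def\<close>)
      then show ?thesis by simp
    qed
    moreover have "range e \<subseteq> multi_indices n" by (auto simp: e_def multi_indices_def)
    ultimately have "(?t has_sum F ?a) (range e)"
      by (subst has_sum_cong_neutral[where T = "multi_indices n"]) auto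
    then have "((\<lambda>i. ?t (e i)) has_sum F ?a) UNIV"
      using has_sum_reindex[OF inj, of ?t "F ?a"] by (simp add: o_def)
    moreover have "?t (e i) = c (e i) * (z - z0) ^ i" for i
    proof -
      have "(\<Prod>r\<in>{1..n} - {j}. ((p(j := z)) r - p' r) ^ e i r) = 1"
        by (rule prod.neutral) (auto simp: e_def)
      then show ?thesis
        using j by (simp add: prod.remove[OF _ j] e_def p'_def)
    qed
    ultimately have "((\<lambda>i. c (e i) * (z - z0) ^ i) has_sum F ?a) UNIV" by (simp only:)
    then show ?thesis by (rule has_sum_imp_sums)
  qed
  have "(\<lambda>z. F (p(j := z))) holomorphic_on ball z0 \<epsilon>"
    by (rule power_series_holomorphic) (rule sums)
  then have "(\<lambda>z. F (p(j := z))) field_differentiable at z0"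
    by (rule holomorphic_on_imp_differentiable_at) (use \<epsilon> in auto)
  then show "(\<lambda>z. F (p(j := z))) field_differentiable (at z0 within ball 0 R)"
    by (rule field_differentiable_at_within)
qed

text \<open>In several variables an accumulation point alone would not suffice; the product
  structure of the agreement set allows the one-variable identity theorem coordinate by
  coordinate.\<close>

lemma analytic_in_variables_eq:
  assumes F: "analytic_in_variables n F (polydisc n R)" and G: "analytic_in_variables n G (polydisc n R)"
    and R: "R > 0" and U: "U \<subseteq> ball 0 R" "0 islimpt U"
    and eq: "\<And>a. \<forall>r\<in>{1..n}. a r \<in> U \<Longrightarrow> F a = G a"
    and a: "a \<in> polydisc n R"
  shows "F a = G a"
proof -
  \<comment> \<open>At stage \<open>j\<close> the first \<open>j\<close> coordinates are free in the
    disc while the later ones are still confined to \<open>U\<close>.\<close>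
  have "\<forall>a\<in>polydisc n R. (\<forall>r\<in>{1..n}. j < r \<longrightarrow> a r \<in> U) \<longrightarrow> F a = G a" if "j \<le> n" for j
    using that
  proof (induction j)
    case 0
    then show ?case using eq by auto
  next
    case (Suc j)
    show ?case
    proof (intro ballI impI)
      fix a assume a: "a \<in> polydisc n R" "\<forall>r\<in>{1..n}. Suc j < r \<longrightarrow> a r \<in> U"
      have j: "Suc j \<in> {1..n}" using Suc.prems by simp
      let ?h = "\<lambda>z. F (a(Suc j := z)) - G (a(Suc j := z))"
      have "?h holomorphic_on ball 0 R"
        by (intro holomorphic_on_diff analytic_in_variables_slice[OF F a(1) j]
            analytic_in_variables_slice[OF G a(1) j])
      moreover have "?h z = 0" if "z \<in> U" for z
      proof -
        have "a(Suc j := z) \<in> polydisc n R" using a that U(1) by (auto simp: polydisc_def)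
        moreover have "\<forall>r\<in>{1..n}. j < r \<longrightarrow> (a(Suc j := z)) r \<in> U" using a that by auto
        ultimately show ?thesis using Suc by simp
      qed
      moreover have "a (Suc j) \<in> ball 0 R" using a j by (simp add: polydisc_def)
      ultimately have "?h (a (Suc j)) = 0"
        using analytic_continuation[of ?h "ball 0 R" U 0 "a (Suc j)"] U R by auto
      then show "F a = G a" by simp
    qed
  qed
  from this[of n] a show ?thesis by auto
qed

lemma zero_islimpt_powers:
  fixes q :: complex
  assumes "0 < norm q" "norm q < 1"
  shows "0 islimpt {q ^ N |N. N0 \<le> N}"
  unfolding islimpt_sequential
proof (intro exI conjI allI)
  show "q ^ (N + N0) \<in> {q ^ N |N. N0 \<le> N} - {0}" for N using assms by auto
  show "(\<lambda>N. q ^ (N + N0)) \<longlonglongrightarrow> 0"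
    using LIMSEQ_ignore_initial_segment[OF LIMSEQ_power_zero[OF assms(2)]] .
qed

section \<open>Deduction of the identity under either hypothesis\<close>

theorem theorem1p4:
  fixes n :: nat and q \<alpha> b :: complex
    and x a :: "nat \<Rightarrow> complex"
    and f :: "(nat \<Rightarrow> complex) \<Rightarrow> complex"
  assumes "n \<ge> 1"
    and "0 < norm q" and "norm q < 1"
    and "denominators_nonzero n q \<alpha> b x a"
    and "(\<exists>R>0. a \<in> polydisc n R \<and>
            (\<forall>a'\<in>polydisc n R. (\<lambda>k. norm (outer_term n q \<alpha> b x f a' k)) summable_on multi_indices n) \<and>
            analytic_in_variables n (lhs n q \<alpha> b f) (polydisc n R) \<and>
            analytic_in_variables n
              (\<lambda>a'. \<Sum>\<^sub>\<infinity>k\<in>multi_indices n. outer_term n q \<alpha> b x f a' k) (polydisc n R))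
         \<or> (\<exists>N :: nat \<Rightarrow> nat. \<forall>r\<in>{1..n}. N r > 0 \<and> a r = q ^ N r)"
  shows "(outer_term n q \<alpha> b x f a has_sum lhs n q \<alpha> b f a) (multi_indices n)"
proof -
  note n = assms(1) and q = assms(2,3)
  have x: "\<And>r. r \<in> {1..n} \<Longrightarrow> x r \<noteq> 0"
    and xx: "\<And>r s. r \<in> {1..n} \<Longrightarrow> s \<in> {1..n} \<Longrightarrow> r < s \<Longrightarrow> 1 - x r / x s \<noteq> 0"
    and qx: "\<And>r s k. r \<in> {1..n} \<Longrightarrow> s \<in> {1..n} \<Longrightarrow> qpoch q (q * x r / x s) k \<noteq> 0"
    and \<alpha>: "1 - \<alpha> \<noteq> 0"
    and den: "\<And>k. qpoch q (\<alpha> * (\<Prod>s=1..n. a s) * q powi (1 - int n)) k \<noteq> 0"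
    and den_b: "qpoch_inf q (\<alpha> * b) \<noteq> 0"
    and den_inf: "qpoch_inf q (\<alpha> * (\<Prod>s=1..n. a s) * q powi (1 - int n)) \<noteq> 0"
    using assms(4) unfolding denominators_nonzero_def by blast+
  have q0: "q \<noteq> 0" using q by auto
  \<comment> \<open>The case \<open>i = 0\<close> comes from the Vandermonde denominators,
    \<open>i = Suc l\<close> from the factor with index \<open>l\<close> of the shifted
    factorials.\<close>
  have x_shift: "x r * q ^ i \<noteq> x s" if "r \<in> {1..n}" "s \<in> {1..n}" "r \<noteq> s" for r s i
  proof
    assume *: "x r * q ^ i = x s"
    show False
    proof (cases i)
      case 0
      then have "x r = x s" using * by simp
      then show False using xx[of r s] xx[of s r] x that by (cases "r < s") auto
    next
      case (Suc l)
      then have "q * x r / x s * q ^ l = 1" using * x[OF that(2)] by (simp add: mult_ac)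
      then show False using qx[OF that(1,2), of "Suc l"] unfolding qpoch_eq_0_iff by blast
    qed
  qed
  interpret generic_nodes n q x
  proof
    show "q \<noteq> 0" by (rule q0)
    show "x r \<noteq> 0" if "r \<in> {1..n}" for r using that by (rule x)
    show "x r * q ^ i \<noteq> x s * q ^ j" if "r \<in> {1..n}" "s \<in> {1..n}" "r \<noteq> s" for r s i j
    proof
      assume eq: "x r * q ^ i = x s * q ^ j"
      show False
      proof (cases "i \<le> j")
        case True
        then have "x s * q ^ (j - i) = x r" using eq q0 by (simp add: power_diff field_simps)
        then show False using x_shift that by blast
      next
        case False
        then have "x r * q ^ (i - j) = x s" using eq q0 by (simp add: power_diff field_simps)
        then show False using x_shift that by blast
      qed
    qed
    show "q ^ Suc i \<noteq> 1" for i
    proof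
      assume "q ^ Suc i = 1"
      then have "norm q ^ Suc i = 1" by (metis norm_one norm_power)
      moreover have "norm q ^ Suc i < 1" using q by (intro power_Suc_less_one) auto
      ultimately show False by simp
    qed
  qed
  from assms(5) show ?thesis
  proof
    assume "\<exists>N :: nat \<Rightarrow> nat. \<forall>r\<in>{1..n}. N r > 0 \<and> a r = q ^ N r"
    then obtain N where "\<And>r. r \<in> {1..n} \<Longrightarrow> N r > 0 \<and> a r = q ^ N r" by blast
    then show ?thesis by (rule terminating_case[OF n q(2) _ \<alpha> den den_b den_inf])
  next
    let ?F = "\<lambda>a'. \<Sum>\<^sub>\<infinity>k\<in>multi_indices n. outer_term n q \<alpha> b x f a' k"
    assume "\<exists>R>0. a \<in> polydisc n R \<and>
            (\<forall>a'\<in>polydisc n R. (\<lambda>k. norm (outer_term n q \<alpha> b x f a' k)) summable_on multi_indices n) \<and>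
            analytic_in_variables n (lhs n q \<alpha> b f) (polydisc n R) \<and>
            analytic_in_variables n ?F (polydisc n R)"
    then obtain R where R: "R > 0" and a: "a \<in> polydisc n R"
      and summable: "(\<lambda>k. norm (outer_term n q \<alpha> b x f a k)) summable_on multi_indices n"
      and analytic: "analytic_in_variables n (lhs n q \<alpha> b f) (polydisc n R)"
        "analytic_in_variables n ?F (polydisc n R)"
      by blast
    \<comment> \<open>The bound \<open>R\<close> keeps the sample points in the polydisc; the other
      bound forces \<open>\<alpha> * q ^ N\<close> into the unit disc, so that the denominators at
      these points cannot vanish.\<close>
    have pos: "0 < min R (1 / (norm \<alpha> + 1))" using R by (simp add: add_nonneg_pos)
    obtain N1 where N1: "norm q ^ N1 < min R (1 / (norm \<alpha> + 1))"
      using real_arch_pow_inv[OF pos q(2)] by blast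
    \<comment> \<open>The successor keeps all sampled exponents positive, as the terminating case
      demands.\<close>
    define N0 where "N0 = Suc N1"
    have small: "norm q ^ N < min R (1 / (norm \<alpha> + 1))" if "N0 \<le> N" for N
      by (rule le_less_trans[OF power_decreasing N1]) (use q that in \<open>auto simp: N0_def\<close>)
    define U where "U = {q ^ N |N. N0 \<le> N}"
    have "lhs n q \<alpha> b f a = ?F a"
    proof (rule analytic_in_variables_eq[OF analytic R _ _ _ a])
      show "U \<subseteq> ball 0 R" using small by (auto simp: U_def norm_power)
      show "0 islimpt U" unfolding U_def by (rule zero_islimpt_powers[OF q])
      fix a' assume "\<forall>r\<in>{1..n}. a' r \<in> U"
      then have "\<forall>r\<in>{1..n}. \<exists>N. N0 \<le> N \<and> a' r = q ^ N" unfolding U_def by blast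
      from bchoice[OF this] obtain N where N: "\<And>r. r \<in> {1..n} \<Longrightarrow> N0 \<le> N r \<and> a' r = q ^ N r"
        by blast
      \<comment> \<open>One exponent supplies \<open>N0\<close>, and the other \<open>n - 1\<close>,
        each at least 1, compensate the factor \<open>q powi (1 - int n)\<close>.\<close>
      have "N0 + (n - 1) \<le> (\<Sum>r=1..n. N r)"
      proof -
        have "(\<Sum>r\<in>{1..n} - {1}. 1) \<le> (\<Sum>r\<in>{1..n} - {1}. N r)"
          by (rule sum_mono) (use N in \<open>force simp: N0_def\<close>)
        moreover have "(\<Sum>r=1..n. N r) = N 1 + (\<Sum>r\<in>{1..n} - {1}. N r)"
          using n by (intro sum.remove) auto
        moreover have "N0 \<le> N 1" using N[of 1] n by simp
        ultimately show ?thesis using n by simp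
      qed
      then obtain d where d: "(\<Sum>r=1..n. N r) = N0 + (n - 1) + d" using le_Suc_ex by blast
      have prod: "(\<Prod>s=1..n. a' s) = q ^ (\<Sum>r=1..n. N r)" using N by (simp add: power_sum)
      have "q ^ (n - 1) * q powi (1 - int n) = 1"
        using q0 n by (simp add: power_int_diff power_diff)
      then have z: "\<alpha> * (\<Prod>s=1..n. a' s) * q powi (1 - int n) = \<alpha> * q ^ (N0 + d)"
        unfolding prod d by (simp add: power_add mult_ac)
      have "norm (\<alpha> * q ^ (N0 + d)) \<le> norm \<alpha> * (1 / (norm \<alpha> + 1))"
        unfolding norm_mult norm_power using small[of "N0 + d"] by (intro mult_left_mono) auto
      also have "\<dots> < 1" by (simp add: divide_less_eq add_nonneg_pos)
      finally have "norm (\<alpha> * (\<Prod>s=1..n. a' s) * q powi (1 - int n)) < 1" unfolding z .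
      note nz = qpoch_nonzero_small[OF q(2) this]
      have "N r > 0 \<and> a' r = q ^ N r" if "r \<in> {1..n}" for r
        using N[OF that] by (auto simp: N0_def)
      then have "(outer_term n q \<alpha> b x f a' has_sum lhs n q \<alpha> b f a') (multi_indices n)"
        by (rule terminating_case[OF n q(2) _ \<alpha> nz(1) den_b nz(2)])
      then show "lhs n q \<alpha> b f a' = ?F a'" by (simp add: infsumI)
    qed
    \<comment> \<open>Summability at \<open>a\<close> is essential here, as \<open>infsum\<close>
      defaults to 0 for families that are not summable.\<close>
    then show ?thesis
      using has_sum_infsum[OF abs_summable_summable[OF summable]] by simp
  qed
qed

end
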